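(* Let $d\ge 1$ be constant, let $\mathcal I=(X,f)$ be an instance of a $d$-objective minimization or maximization problem satisfying the standing assumptions, let $\alpha\ge 1$, let $\mathtt{ALG}_\alpha$ be an $\alpha$-approximation algorithm for the weighted sum scalarization, and let $0<\varepsilon<1$. Then the algorithm $\mathtt{OAA}$ (described in the context), applied to $\mathcal I$, $\varepsilon$ and $\mathtt{ALG}_\alpha$, terminates and returns a $((1+\varepsilon)\cdot\alpha)$-convex approximation set $S$ for $\mathcal I$ in time $$\mathcal O\left(T_{\mathrm{LB}/\mathrm{UB}}+|\Lambda^{\mathrm{Grid}}|^{\lfloor d/2\rfloor+2}+|\Lambda^{\mathrm{Grid}}|\cdot T_{\mathtt{ALG}_\alpha}\right),$$ where $T_{\mathrm{LB}/\mathrm{UB}}$ denotes the time needed for computing the bounds $\mathrm{LB}$ and $\mathrm{UB}$, and $T_{\mathtt{ALG}_\alpha}$ denotes the running time of $\mathtt{ALG}_\alpha$.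
   Context: Problems. An instance $\mathcal I=(X,f)$ of a $d$-objective minimization (maximization) problem consists of a nonempty set $X$ of feasible solutions and $f=(f_1,\dots,f_d)$, $f_i:X\to\mathbb R$, all to be minimized (maximized). $\leqq,\geqq$ denote the weak componentwise orders on $\mathbb R^d$, and $\mathbb R^d_\geqq=\{y\in\mathbb R^d: y\geqq 0\}$. Standing assumptions: $d$ is constant; the values $f_i(x)$ are nonnegative rationals, polynomial-time computable, with encoding length at most some $m$ that is polynomially bounded in the encoding length of $\mathcal I$ (so $f(X)$ is finite); positive rationals $\mathrm{LB}\le\mathrm{UB}$ with $2^{-m}\le \mathrm{LB}$, $\mathrm{UB}\le 2^m$ and $f_i(x)\in\{0\}\cup[\mathrm{LB},\mathrm{UB}]$ for all $x\in X$ and all $i$ can be computed in polynomial time. Approximation. For $\beta\ge1$, $S\subseteq X$ is a $\beta$-convex approximation set if for each $x'\in X$ there are $L\ge 1$, $x^1,\dots,x^L\in S$ and $\theta_1,\dots,\theta_L\ge0$ with $\sum_\ell\theta_\ell=1$ such that $\sum_\ell\theta_\ell f(x^\ell)\leqq\beta f(x')$ (minimization), respectively $\sum_\ell\theta_\ell f(x^\ell)\geqq\frac1\beta f(x')$ (maximization). For $\lambda\in\mathbb R^d_\geqq\setminus\{0\}$, $x\in X$ is a $\beta$-approximation for $\lambda$ if $\lambda^\top f(x)\le\beta\lambda^\top f(x')$ (resp. $\lambda^\top f(x)\ge\frac1\beta\lambda^\top f(x')$) for all $x'\in X$. An $\alpha$-approximation algorithm $\mathtt{ALG}_\alpha$ for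 the weighted sum scalarization returns, for every instance and every $\lambda\in\mathbb R^d_\geqq\setminus\{0\}$, an $\alpha$-approximation for $\lambda$ in polynomial time. Weight set and grid. $\Lambda=\{\lambda\in\mathbb R^d_\geqq:\|\lambda\|_1=1\}$. Set $\varepsilon'=\sqrt{1+\varepsilon}-1$, $\beta=(1+\varepsilon')\alpha$, $c=\frac{\varepsilon'\mathrm{LB}}{\beta\,\mathrm{UB}}$, $\mathrm{lb}=\frac1{d!}c^{d-1}$, and let $\Lambda^{\mathrm{Grid}}$ be the set of all $\lambda'/\|\lambda'\|_1$ with $\lambda'_i=(1+\varepsilon')^{a_i}$, $a_i\in\mathbb Z$, $\log_{1+\varepsilon'}(\mathrm{lb})\le a_i\le\log_{1+\varepsilon'}(1-(d-1)\mathrm{lb})+1$ for $i=1,\dots,d$. Polyhedron. For finite $S\subseteq X$, $D(S)=\bigcap_{x\in S}H(x)$, where $H(x)=\{(\lambda,z)\in\Lambda\times\mathbb R:\lambda^\top f(x)\ge z\}$ for minimization and $H(x)=\{(\lambda,z)\in\Lambda\times\mathbb R:\lambda^\top f(x)\le z\}$ for maximization. $\mathtt{BoundaryRounding}(\lambda)$: let $\sigma$ be a permutation with $\lambda_{\sigma(1)}\le\dots\le\lambda_{\sigma(d)}$; put $\bar\lambda_i=\lambda_{\sigma(i)}$ and $bool=\mathrm{FALSE}$. For $k=1,\dots,d-1$: if $\sum_{j=1}^k\bar\lambda_j<c\,\bar\lambda_{k+1}$, set $bool=\mathrm{TRUE}$, let $a=\sum_{i=1}^k\bar\lambda_i$ and,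 for $i=1,\dots,k$, replace $\bar\lambda_i$ by $\frac{\bar\lambda_i}{a}c\bar\lambda_{k+1}$ if $a>0$ and by $\frac{c}{k}\bar\lambda_{k+1}$ if $a=0$. Undo the permutation, normalize to $\|\cdot\|_1=1$, and return the result together with $bool$. $\mathtt{GridRounding}(\lambda,\delta)$: put $\bar\lambda_i=(1+\delta)^{\lceil\log_{1+\delta}(\lambda_i)\rceil}$ for $i=1,\dots,d$ and return $\bar\lambda/\|\bar\lambda\|_1$. $\mathtt{OAA}$: compute $\mathrm{LB},\mathrm{UB},\varepsilon',\beta$; let $\lambda=(\frac1d,\dots,\frac1d)$, $x=\mathtt{ALG}_\alpha(\lambda)$, $S=\{x\}$, $R=\{\lambda\}$, and let $M$ be the set of extreme points of $D(S)$. While $M\ne\emptyset$: remove some $(\lambda^*,z^* )$ from $M$; compute $(\lambda',bool)=\mathtt{BoundaryRounding}(\lambda^* )$; let $\lambda''=\mathtt{GridRounding}(\lambda',\varepsilon')$ if $bool=\mathrm{TRUE}$ and $\lambda''=\mathtt{GridRounding}(\lambda',\varepsilon)$ otherwise; if $\lambda''\notin R$, compute $x''=\mathtt{ALG}_\alpha(\lambda'')$, add $x''$ to $S$ and $\lambda''$ to $R$, and reset $M$ to the set of all extreme points of $D(S)$. Return $S$. Conventions: constants in $\mathcal O$ may depend on $d$; extreme points are computed by an algorithm that, for a $d$-dimensional polyhedron given by $n$ half-spaces, runs in time $\mathcal O(n\log n+n^{\lfloor d/2\rfloor})$ (Chazelle); inserting into and testing membership in $R$ takes constant time. *)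

theory Defs
  imports
    "HOL-Analysis.Analysis"
    "HOL-Computational_Algebra.Polynomial"
    "HOL-Library.While_Combinator"
begin

text \<open>
  An algorithm is a function that returns its result together with its running time.
  Time is counted on a real RAM: one unit for each arithmetic operation (including roots,
  logarithms, powers and rounding up), comparison, assignment, and access to or update of a
  set. The coordinates are indexed by a finite type \<open>'d\<close>, and \<open>d = CARD('d)\<close>.
\<close>

type_synonym 'a timed = "'a \<times> nat"

abbreviation result :: "'a timed \<Rightarrow> 'a" where "result \<equiv> fst"
abbreviation runtime :: "'a timed \<Rightarrow> nat" where "runtime \<equiv> snd"


section \<open>Multiobjective problems\<close>

datatype sense = Minimize | Maximize

record ('i, 'x, 'd) problem =
  sense :: sense
  enc :: "'i \<Rightarrow> nat"  \<comment> \<open>encoding length of an instance\<close>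
  feasible :: "'i \<Rightarrow> 'x set"
  objective :: "'i \<Rightarrow> 'x \<Rightarrow> real ^ 'd"

definition rat_enc :: "rat \<Rightarrow> nat" where
  "rat_enc r = (case quotient_of r of (p, q) \<Rightarrow>
     1 + nat \<lceil>log 2 (real_of_int \<bar>p\<bar> + 1)\<rceil> + nat \<lceil>log 2 (real_of_int q + 1)\<rceil>)"

definition poly_bounded :: "('i \<Rightarrow> nat) \<Rightarrow> ('i \<Rightarrow> nat) \<Rightarrow> bool" where
  "poly_bounded len g \<longleftrightarrow> (\<exists>p :: nat poly. \<forall>i. g i \<le> poly p (len i))"

text \<open>
  \<open>eval\<close> is the algorithm evaluating the objectives and \<open>bnd\<close> the one computing
  \<open>(LB, UB)\<close>.
\<close>

definition standing_assumptions ::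
  "('i, 'x, 'd::finite) problem \<Rightarrow> ('i \<Rightarrow> nat) \<Rightarrow> ('i \<Rightarrow> 'x \<Rightarrow> (real ^ 'd) timed) \<Rightarrow>
   ('i \<Rightarrow> (real \<times> real) timed) \<Rightarrow> bool" where
  "standing_assumptions P m eval bnd \<longleftrightarrow>
     (\<forall>i. feasible P i \<noteq> {}) \<and>
     poly_bounded (enc P) m \<and>
     (\<forall>i. \<forall>x\<in>feasible P i. \<forall>j.
        \<exists>q::rat. objective P i x $ j = of_rat q \<and> 0 \<le> q \<and> rat_enc q \<le> m i) \<and>
     (\<forall>i. \<forall>x\<in>feasible P i. result (eval i x) = objective P i x) \<and>
     (\<exists>p :: nat poly. \<forall>i. \<forall>x\<in>feasible P i. runtime (eval i x) \<le> poly p (enc P i)) \<and>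
     (\<forall>i. case result (bnd i) of (LB, UB) \<Rightarrow>
        LB \<in> \<rat> \<and> UB \<in> \<rat> \<and> 0 < LB \<and> LB \<le> UB \<and> 1 / 2 ^ m i \<le> LB \<and> UB \<le> 2 ^ m i \<and>
        (\<forall>x\<in>feasible P i. \<forall>j. objective P i x $ j \<in> {0} \<union> {LB..UB})) \<and>
     poly_bounded (enc P) (\<lambda>i. runtime (bnd i))"


section \<open>Approximation\<close>

text \<open>The order \<open>\<le>\<close> on \<open>real ^ 'd\<close> is the componentwise one.\<close>

definition convex_approximation_set ::
  "sense \<Rightarrow> 'x set \<Rightarrow> ('x \<Rightarrow> real ^ 'd) \<Rightarrow> real \<Rightarrow> 'x set \<Rightarrow> bool" where
  "convex_approximation_set s X f \<beta> S \<longleftrightarrow>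
     S \<subseteq> X \<and>
     (\<forall>x'\<in>X. \<exists>L \<ge> (1::nat). \<exists>x :: nat \<Rightarrow> 'x. \<exists>\<theta> :: nat \<Rightarrow> real.
        (\<forall>l\<in>{1..L}. x l \<in> S \<and> 0 \<le> \<theta> l) \<and> (\<Sum>l=1..L. \<theta> l) = 1 \<and>
        (case s of
           Minimize \<Rightarrow> (\<Sum>l=1..L. \<theta> l *\<^sub>R f (x l)) \<le> \<beta> *\<^sub>R f x'
         | Maximize \<Rightarrow> (\<Sum>l=1..L. \<theta> l *\<^sub>R f (x l)) \<ge> (1 / \<beta>) *\<^sub>R f x'))"

definition approximation_for ::
  "sense \<Rightarrow> 'x set \<Rightarrow> ('x \<Rightarrow> real ^ 'd) \<Rightarrow> real \<Rightarrow> real ^ 'd \<Rightarrow> 'x \<Rightarrow> bool" where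
  "approximation_for s X f \<beta> w x \<longleftrightarrow>
     x \<in> X \<and>
     (\<forall>x'\<in>X. case s of
        Minimize \<Rightarrow> w \<bullet> f x \<le> \<beta> * (w \<bullet> f x')
      | Maximize \<Rightarrow> w \<bullet> f x \<ge> 1 / \<beta> * (w \<bullet> f x'))"

text \<open>
  The running time is polynomial in the encoding length of the input, that is, of the instance
  and of the weight. Since weights are real vectors, their length is measured by an arbitrary
  function \<open>wenc\<close>; a constant \<open>wenc\<close> yields bounds in the instance alone.
\<close>

definition weighted_sum_algorithm ::
  "('i, 'x, 'd::finite) problem \<Rightarrow> (real ^ 'd \<Rightarrow> nat) \<Rightarrow> real \<Rightarrow>
   ('i \<Rightarrow> real ^ 'd \<Rightarrow> 'x timed) \<Rightarrow> bool" where
  "weighted_sum_algorithm P wenc \<alpha> alg \<longleftrightarrow>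
     (\<forall>i w. 0 \<le> w \<and> w \<noteq> 0 \<longrightarrow>
        approximation_for (sense P) (feasible P i) (objective P i) \<alpha> w (result (alg i w))) \<and>
     (\<exists>p :: nat poly. \<forall>i w. 0 \<le> w \<and> w \<noteq> 0 \<longrightarrow>
        runtime (alg i w) \<le> poly p (enc P i + wenc w))"


text \<open>
  The running time of the algorithm on a fixed instance is its worst case over a set of
  weights. The set is the grid in the theorem, which contains all weights that arise: over
  all real weights there need not be a finite worst case.
\<close>

definition worst_runtime :: "('w \<Rightarrow> 'x timed) \<Rightarrow> 'w set \<Rightarrow> nat" where
  "worst_runtime alg W = Max ((\<lambda>w. runtime (alg w)) ` W)"


section \<open>Weight set and grid\<close>

definition norm1 :: "real ^ 'd \<Rightarrow> real" where
  "norm1 w = (\<Sum>i\<in>UNIV. \<bar>w $ i\<bar>)"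

definition normalize1 :: "real ^ 'd \<Rightarrow> real ^ 'd" where
  "normalize1 w = (1 / norm1 w) *\<^sub>R w"

definition weights :: "(real ^ 'd) set" where
  "weights = {w. 0 \<le> w \<and> norm1 w = 1}"

definition eps' :: "real \<Rightarrow> real" where
  "eps' \<epsilon> = sqrt (1 + \<epsilon>) - 1"

definition ratio_c :: "real \<Rightarrow> real \<Rightarrow> real \<times> real \<Rightarrow> real" where
  "ratio_c \<epsilon> \<alpha> = (\<lambda>(LB, UB). let \<beta> = (1 + eps' \<epsilon>) * \<alpha> in eps' \<epsilon> * LB / (\<beta> * UB))"

definition weight_lb :: "nat \<Rightarrow> real \<Rightarrow> real" where
  "weight_lb d c = 1 / fact d * c ^ (d - 1)"

text \<open>\<open>b\<close> is the pair \<open>(LB, UB)\<close>.\<close>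

definition grid :: "real \<Rightarrow> real \<Rightarrow> real \<times> real \<Rightarrow> (real ^ 'd::finite) set" where
  "grid \<epsilon> \<alpha> b =
     (let d = CARD('d); e = eps' \<epsilon>; l = weight_lb d (ratio_c \<epsilon> \<alpha> b) in
      {normalize1 (\<chi> i. (1 + e) powi (a i)) | a :: 'd \<Rightarrow> int.
         \<forall>i. log (1 + e) l \<le> real_of_int (a i) \<and>
             real_of_int (a i) \<le> log (1 + e) (1 - (real d - 1) * l) + 1})"


section \<open>The polyhedron and its extreme points\<close>

definition Hset :: "sense \<Rightarrow> ('x \<Rightarrow> real ^ 'd) \<Rightarrow> 'x \<Rightarrow> ((real ^ 'd) \<times> real) set" where
  "Hset s f x = {(w, z). w \<in> weights \<and>
     (case s of Minimize \<Rightarrow> w \<bullet> f x \<ge> z | Maximize \<Rightarrow> w \<bullet> f x \<le> z)}"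

definition Dset :: "sense \<Rightarrow> ('x \<Rightarrow> real ^ 'd) \<Rightarrow> 'x set \<Rightarrow> ((real ^ 'd) \<times> real) set" where
  "Dset s f S = (\<Inter>x\<in>S. Hset s f x)"

text \<open>A pair \<open>(a, b)\<close> represents the half-space of all \<open>p\<close> with \<open>a \<bullet> p \<le> b\<close>.\<close>

type_synonym 'd halfspace = "((real ^ 'd) \<times> real) \<times> real"

definition polyhedron_of :: "'d::finite halfspace set \<Rightarrow> ((real ^ 'd) \<times> real) set" where
  "polyhedron_of H = (\<Inter>(a, b)\<in>H. {p. a \<bullet> p \<le> b})"

text \<open>
  The polyhedra \<open>D(S)\<close> have dimension \<open>d\<close> and lie in the \<open>(d+1)\<close>-dimensional space of
  pairs of a weight and a real. The running time of an algorithm is at least the number of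
  points it outputs.
\<close>

definition extreme_point_algorithm ::
  "('d::finite halfspace set \<Rightarrow> ((real ^ 'd) \<times> real) set timed) \<Rightarrow> bool" where
  "extreme_point_algorithm ext \<longleftrightarrow>
     (\<exists>K::real. \<forall>H. finite H \<and> aff_dim (polyhedron_of H) = int CARD('d) \<longrightarrow>
        result (ext H) = {p. p extreme_point_of polyhedron_of H} \<and>
        card (result (ext H)) \<le> runtime (ext H) \<and>
        real (runtime (ext H)) \<le>
          K * (real (card H) * log 2 (real (card H)) + real (card H) ^ (CARD('d) div 2)))"

text \<open>
  The half-spaces describing \<open>D(S)\<close>; the equation \<open>norm1 w = 1\<close> contributes two of them.
\<close>

definition D_halfspaces :: "sense \<Rightarrow> ('x \<Rightarrow> real ^ 'd::finite) \<Rightarrow> 'x set \<Rightarrow> 'd halfspace set" where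
  "D_halfspaces s f S =
     (case s of
        Minimize \<Rightarrow> (\<lambda>x. ((- f x, 1), 0)) ` S
      | Maximize \<Rightarrow> (\<lambda>x. ((f x, - 1), 0)) ` S) \<union>
     range (\<lambda>i. ((- axis i 1, 0), 0)) \<union>
     {(((\<chi> i. 1), 0), 1), (((\<chi> i. - 1), 0), - 1)}"

lemma polyhedron_of_D_halfspaces:
  fixes f :: "'x \<Rightarrow> real ^ 'd::finite"
  assumes "S \<noteq> {}"
  shows "polyhedron_of (D_halfspaces s f S) = Dset s f S"
proof -
  have weights_iff: "(w :: real ^ 'd) \<in> weights \<longleftrightarrow>
      (\<forall>i. 0 \<le> w $ i) \<and> (\<chi> i. 1) \<bullet> w \<le> 1 \<and> (\<chi> i. - 1) \<bullet> w \<le> - 1" for w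
    by (auto simp: weights_def norm1_def less_eq_vec_def inner_vec_def sum_negf)
  show ?thesis
    using assms
    by (cases s) (auto simp: polyhedron_of_def D_halfspaces_def Dset_def Hset_def weights_iff
        inner_axis inner_commute ball_Un)
qed


section \<open>Rounding\<close>

text \<open>A permutation as in \<open>BoundaryRounding\<close>; positions are \<open>1, ..., d\<close>.\<close>

definition sorts :: "(nat \<Rightarrow> 'd) \<Rightarrow> real ^ 'd::finite \<Rightarrow> bool" where
  "sorts \<sigma> w \<longleftrightarrow> bij_betw \<sigma> {1..CARD('d)} UNIV \<and>
     (\<forall>i j. 1 \<le> i \<and> i \<le> j \<and> j \<le> CARD('d) \<longrightarrow> w $ \<sigma> i \<le> w $ \<sigma> j)"

text \<open>
  Iteration \<open>k\<close> of the loop. The last component of the state is the time: the sum, the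
  product, the comparison and the loop counter take \<open>k + 2\<close> units; the assignment of the
  flag, the sum \<open>a\<close>, and the comparison with \<open>0\<close>, at most three operations and one
  assignment for each of \<open>k\<close> entries take at most \<open>1 + k + 5 * k\<close> units.
\<close>

definition boundary_step ::
  "real \<Rightarrow> nat \<Rightarrow> (nat \<Rightarrow> real) \<times> bool \<times> nat \<Rightarrow> (nat \<Rightarrow> real) \<times> bool \<times> nat" where
  "boundary_step c k = (\<lambda>(v, bool, t).
     if (\<Sum>j=1..k. v j) < c * v (k + 1) then
       (let a = (\<Sum>i=1..k. v i) in
        ((\<lambda>i. if i \<in> {1..k}
              then (if a > 0 then v i / a * c * v (k + 1) else c / real k * v (k + 1))
              else v i),
         True, t + (k + 2) + (1 + k + 5 * k)))
     else (v, bool, t + (k + 2)))"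

text \<open>
  The permutation is found with at most \<open>d\<^sup>2\<close> comparisons; permuting, unpermuting and
  normalizing take \<open>d\<close>, \<open>d\<close> and \<open>2 * d\<close> units.
\<close>

definition boundary_rounding ::
  "(real ^ 'd \<Rightarrow> nat \<Rightarrow> 'd) \<Rightarrow> real \<Rightarrow> real ^ 'd::finite \<Rightarrow> ((real ^ 'd) \<times> bool) timed" where
  "boundary_rounding srt c w =
     (let d = CARD('d); \<sigma> = srt w;
          (v, bool, t) = fold (boundary_step c) [1..<d] (\<lambda>i. w $ \<sigma> i, False, 0)
      in ((normalize1 (\<chi> i. v (inv_into {1..d} \<sigma> i)), bool), d ^ 2 + d + t + d + 2 * d))"

definition grid_rounding :: "real \<Rightarrow> real ^ 'd::finite \<Rightarrow> (real ^ 'd) timed" where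
  "grid_rounding \<delta> w =
     (normalize1 (\<chi> i. (1 + \<delta>) powi \<lceil>log (1 + \<delta>) (w $ i)\<rceil>), 4 * CARD('d) + 2 * CARD('d))"


section \<open>The algorithm\<close>

record ('x, 'd) oaa_state =
  Sols :: "'x set"
  Rset :: "(real ^ 'd) set"
  Mset :: "((real ^ 'd) \<times> real) set"
  clock :: nat

text \<open>
  Set up the half-spaces describing \<open>D(S)\<close>, each with \<open>d + 2\<close> coefficients, and compute the
  extreme points. The objective values of solutions returned by the weighted sum algorithm
  are at hand.
\<close>

definition extreme_points ::
  "sense \<Rightarrow> ('x \<Rightarrow> real ^ 'd::finite) \<Rightarrow> ('d halfspace set \<Rightarrow> ((real ^ 'd) \<times> real) set timed) \<Rightarrow>
   'x set \<Rightarrow> ((real ^ 'd) \<times> real) set timed" where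
  "extreme_points s f ext S =
     (let H = D_halfspaces s f S; (M, t) = ext H in (M, card H * (CARD('d) + 2) + t))"

text \<open>
  Computing \<open>\<epsilon>'\<close>, \<open>\<beta>\<close> and \<open>c\<close> takes 8 units, the uniform weight \<open>d\<close> units, and the
  assignments of \<open>S\<close> and \<open>R\<close> 2 units.
\<close>

definition oaa_init ::
  "sense \<Rightarrow> ('x \<Rightarrow> real ^ 'd::finite) \<Rightarrow> (real \<times> real) timed \<Rightarrow> (real ^ 'd \<Rightarrow> 'x timed) \<Rightarrow>
   ('d halfspace set \<Rightarrow> ((real ^ 'd) \<times> real) set timed) \<Rightarrow> ('x, 'd) oaa_state" where
  "oaa_init s f bnd alg ext =
     (let d = CARD('d); w = (\<chi> i. 1 / real d);
          (x, t\<^sub>x) = alg w;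
          (M, t\<^sub>M) = extreme_points s f ext {x}
      in \<lparr>Sols = {x}, Rset = {w}, Mset = M, clock = runtime bnd + 8 + d + t\<^sub>x + 2 + t\<^sub>M\<rparr>)"

text \<open>
  The choice of the element to be removed is made by \<open>sel\<close>, which may depend on the whole
  state. As the clock never returns to a previous value, every sequence of choices arises
  from some \<open>sel\<close>. Testing the loop condition, removing the element, branching on the flag
  and testing membership in \<open>R\<close> take one unit each, as do the insertions into \<open>S\<close> and \<open>R\<close>.
\<close>

definition oaa_body ::
  "sense \<Rightarrow> ('x \<Rightarrow> real ^ 'd::finite) \<Rightarrow> real \<times> real \<Rightarrow> real \<Rightarrow> (real ^ 'd \<Rightarrow> 'x timed) \<Rightarrow>
   ('d halfspace set \<Rightarrow> ((real ^ 'd) \<times> real) set timed) \<Rightarrow> real \<Rightarrow>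
   (real ^ 'd \<Rightarrow> nat \<Rightarrow> 'd) \<Rightarrow> (('x, 'd) oaa_state \<Rightarrow> (real ^ 'd) \<times> real) \<Rightarrow>
   ('x, 'd) oaa_state \<Rightarrow> ('x, 'd) oaa_state" where
  "oaa_body s f b \<alpha> alg ext \<epsilon> srt sel st =
     (let (w, z) = sel st;
          M = Mset st - {(w, z)};
          ((w', bool), t') = boundary_rounding srt (ratio_c \<epsilon> \<alpha> b) w;
          (w'', t'') = (if bool then grid_rounding (eps' \<epsilon>) w' else grid_rounding \<epsilon> w');
          t = clock st + 4 + t' + t''
      in if w'' \<in> Rset st then st\<lparr>Mset := M, clock := t\<rparr>
         else
           (let (x'', t\<^sub>x) = alg w'';
                S = insert x'' (Sols st);
                R = insert w'' (Rset st);
                (M', t\<^sub>M) = extreme_points s f ext S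
            in \<lparr>Sols = S, Rset = R, Mset = M', clock = t + t\<^sub>x + 2 + t\<^sub>M\<rparr>))"

text \<open>The result is \<open>None\<close> iff the loop does not terminate.\<close>

definition oaa ::
  "sense \<Rightarrow> ('x \<Rightarrow> real ^ 'd::finite) \<Rightarrow> (real \<times> real) timed \<Rightarrow> real \<Rightarrow>
   (real ^ 'd \<Rightarrow> 'x timed) \<Rightarrow> ('d halfspace set \<Rightarrow> ((real ^ 'd) \<times> real) set timed) \<Rightarrow> real \<Rightarrow>
   (real ^ 'd \<Rightarrow> nat \<Rightarrow> 'd) \<Rightarrow> (('x, 'd) oaa_state \<Rightarrow> (real ^ 'd) \<times> real) \<Rightarrow>
   'x set timed option" where
  "oaa s f bnd \<alpha> alg ext \<epsilon> srt sel =
     map_option (\<lambda>st. (Sols st, clock st + 1))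
       (while_option (\<lambda>st. Mset st \<noteq> {}) (oaa_body s f (result bnd) \<alpha> alg ext \<epsilon> srt sel)
         (oaa_init s f bnd alg ext))"

end

theory Submission
  imports Defs
begin

text \<open>
  Every weight that is rounded lies in the grid: after boundary rounding the sorted entries satisfy
  \<open>c * v (k + 1) \<le> v 1 + \<dots> + v k\<close>, which chains to \<open>weight_lb\<close> as a lower bound on the
  normalized entries. As each recomputation of the extreme points adds a new grid weight to \<open>R\<close>,
  and between two of them \<open>M\<close> shrinks, the loop ends after at most \<open>|G|\<close> recomputations, each for
  a polyhedron with at most \<open>|G| + d + 2\<close> half-spaces.

  When \<open>M\<close> is empty, the rounded weight of every extreme point of \<open>D(S)\<close> is in \<open>R\<close>, so some
  solution in \<open>S\<close> is an \<open>\<alpha>\<close>-approximation for it. Rounding loses a factor \<open>1 + \<epsilon>\<close> in total: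
  grid rounding by \<open>1 + \<epsilon>\<close> alone, or by \<open>1 + \<epsilon>'\<close> together with a factor \<open>1 + \<epsilon>'\<close> for the
  boundary. As \<open>D(S)\<close> is generated by its extreme points and a vertical ray, \<open>S\<close> contains an
  approximation for every weight, and separating the convex hull of \<open>f(S)\<close> from an orthant turns
  this into a convex approximation set.
\<close>

section \<open>Weights and extreme points\<close>

lemma weights_iff: "w \<in> weights \<longleftrightarrow> (\<forall>i. 0 \<le> w $ i) \<and> (\<Sum>i\<in>UNIV. w $ i) = 1"
  by (auto simp: weights_def norm1_def less_eq_vec_def)

lemma sum_pos_of_nonneg_nonzero:
  fixes w :: "real ^ 'd::finite"
  assumes "0 \<le> w" "w \<noteq> 0"
  shows "0 < (\<Sum>i\<in>UNIV. w $ i)"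
proof -
  obtain i where "w $ i \<noteq> 0" using assms(2) by (auto simp: vec_eq_iff)
  then have "0 < w $ i" using assms(1) by (auto simp: less_eq_vec_def order_less_le)
  then show ?thesis using assms(1) by (intro sum_pos2[of _ i]) (auto simp: less_eq_vec_def)
qed

lemma norm1_nonneg_eq: "0 \<le> w \<Longrightarrow> norm1 w = (\<Sum>i\<in>UNIV. w $ i)"
  by (simp add: norm1_def less_eq_vec_def)

lemma norm1_pos:
  fixes w :: "real ^ 'd::finite"
  shows "0 \<le> w \<Longrightarrow> w \<noteq> 0 \<Longrightarrow> 0 < norm1 w"
  by (simp add: norm1_nonneg_eq sum_pos_of_nonneg_nonzero)

lemma normalize1_in_weights:
  fixes w :: "real ^ 'd::finite"
  assumes "0 \<le> w" "w \<noteq> 0"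
  shows "normalize1 w \<in> weights"
  using assms norm1_pos[OF assms] norm1_nonneg_eq[OF assms(1)]
  by (auto simp: weights_iff normalize1_def less_eq_vec_def simp flip: sum_divide_distrib)

lemma normalize1_weights: "w \<in> weights \<Longrightarrow> normalize1 w = w"
  by (simp add: weights_def normalize1_def)

lemma convex_weights: "convex (weights :: (real ^ 'd::finite) set)"
  unfolding convex_def
  by (auto simp: weights_iff sum.distrib simp flip: sum_distrib_left)

lemma closed_weights: "closed (weights :: (real ^ 'd::finite) set)"
proof -
  have "weights = (\<Inter>i. {w :: real ^ 'd. 0 \<le> w $ i}) \<inter> {w. (\<Sum>i\<in>UNIV. w $ i) = 1}"
    by (auto simp: weights_iff)
  also have "closed \<dots>"
    by (intro closed_Int closed_INT ballI closed_Collect_le closed_Collect_eq continuous_intros)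
  finally show ?thesis .
qed

lemma compact_weights: "compact (weights :: (real ^ 'd::finite) set)"
proof -
  have "norm w \<le> 1" if "w \<in> weights" for w :: "real ^ 'd"
    using norm_le_l1_cart[of w] that by (simp add: weights_def norm1_def)
  then show ?thesis
    by (auto simp: compact_eq_bounded_closed bounded_iff closed_weights)
qed

section \<open>The region below a minimum of linear functions on the weight simplex\<close>

definition hypo :: "(real ^ 'd) set \<Rightarrow> ((real ^ 'd) \<times> real) set" where
  "hypo Y = {(w, z). w \<in> weights \<and> (\<forall>y\<in>Y. z \<le> w \<bullet> y)}"

lemma convex_hypo: "convex (hypo (Y :: (real ^ 'd::finite) set))"
proof -
  have "hypo Y = (weights \<times> UNIV) \<inter> (\<Inter>y\<in>Y. {p. (- y, 1) \<bullet> p \<le> 0})"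
    by (auto simp: hypo_def inner_commute)
  then show ?thesis
    by (simp add: convex_Int convex_INT convex_Times convex_weights convex_halfspace_le)
qed

lemma closed_hypo: "closed (hypo (Y :: (real ^ 'd::finite) set))"
proof -
  have "hypo Y = (weights \<times> UNIV) \<inter> (\<Inter>y\<in>Y. {p. (- y, 1) \<bullet> p \<le> 0})"
    by (auto simp: hypo_def inner_commute)
  then show ?thesis
    by (simp add: closed_Int closed_INT closed_Times closed_weights closed_halfspace_le)
qed

text \<open>Extremality is a local property: a segment in \<open>D\<close> around
  \<open>(w, z)\<close> can be shrunk towards \<open>(w, z)\<close> until it stays above level
  \<open>t\<close>, so it would refute extremality in the truncated set as well. This allows cutting
  off the unbounded direction.\<close>

lemma extreme_point_of_Int_above:
  fixes D :: "('a::real_vector \<times> real) set"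
  assumes D: "convex D" and ext: "(w, z) extreme_point_of (D \<inter> {p. t \<le> snd p})" and z: "t < z"
  shows "(w, z) extreme_point_of D"
proof -
  have "(w, z) \<notin> open_segment a b" if a: "a \<in> D" and b: "b \<in> D" for a b
  proof
    assume "(w, z) \<in> open_segment a b"
    then obtain u where ab: "a \<noteq> b" and u: "0 < u" "u < 1"
      and p: "(w, z) = (1 - u) *\<^sub>R a + u *\<^sub>R b"
      by (auto simp: in_segment)
    have wz: "(w, z) \<in> D" using ext by (simp add: extreme_point_of_def)
    \<comment> \<open>\<open>m\<close> bounds the height difference of both ends to
      \<open>z\<close>, and the summand 1 keeps it positive. Shrinking by \<open>r\<close> then
      lowers the height by at most \<open>r * m\<close>, which is within the slack
      \<open>z - t\<close>.\<close>
    define m where "m = \<bar>snd a - z\<bar> + \<bar>snd b - z\<bar> + 1"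
    define r where "r = min 1 ((z - t) / m)"
    have m: "0 < m" by (simp add: m_def)
    have r: "0 < r" "r \<le> 1" using z m by (auto simp: r_def)
    have rm: "r * m \<le> z - t" using m by (simp add: r_def min_def field_simps)
    let ?q = "\<lambda>c. (1 - r) *\<^sub>R (w, z) + r *\<^sub>R c"
    have q: "?q c \<in> D \<inter> {p. t \<le> snd p}" if c: "c \<in> D" "\<bar>snd c - z\<bar> \<le> m" for c
    proof -
      have "?q c \<in> D" using D wz c(1) r by (intro convexD) auto
      moreover have "r * (z - snd c) \<le> r * m" using c(2) r by (intro mult_left_mono) auto
      then have "t \<le> snd (?q c)" using rm by (simp add: algebra_simps)
      ultimately show ?thesis by simp
    qed
    have "?q a \<in> D \<inter> {p. t \<le> snd p}" "?q b \<in> D \<inter> {p. t \<le> snd p}"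
      using a b by (auto intro!: q simp: m_def simp del: Int_iff scaleR_Pair)
    moreover have "(w, z) \<in> open_segment (?q a) (?q b)"
    proof -
      have "?q a \<noteq> ?q b" using ab r by simp
      moreover have "(1 - u) *\<^sub>R ?q a + u *\<^sub>R ?q b
          = (1 - r) *\<^sub>R (w, z) + r *\<^sub>R ((1 - u) *\<^sub>R a + u *\<^sub>R b)"
        by (simp add: algebra_simps)
      then have "(w, z) = (1 - u) *\<^sub>R ?q a + u *\<^sub>R ?q b"
        unfolding p[symmetric] by (simp add: algebra_simps)
      ultimately show ?thesis using u unfolding in_segment by blast
    qed
    ultimately show False using ext by (auto simp: extreme_point_of_def)
  qed
  then show ?thesis using ext by (simp add: extreme_point_of_def)
qed

lemma weights_inner_bound:
  fixes y :: "real ^ 'd::finite"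
  assumes "w \<in> weights"
  shows "\<bar>w \<bullet> y\<bar> \<le> norm y"
proof -
  have "norm w \<le> 1"
    using norm_le_l1_cart[of w] assms by (simp add: weights_def norm1_def)
  then show ?thesis
    using Cauchy_Schwarz_ineq2[of w y] mult_right_mono[of "norm w" 1 "norm y"] by simp
qed

text \<open>Cut off below at \<open>- N\<close>, the region is compact and thus the convex hull of
  its extreme points. Those above the cut are extreme in \<open>hypo Y\<close> and satisfy the
  hypothesis; those on the cut lie below the graph of \<open>y0\<close> because \<open>N\<close> is
  large. Hence the whole truncated region lies below that graph, in particular its top point over
  \<open>w\<close>.\<close>

lemma extreme_points_hypo_dominate:
  fixes Y :: "(real ^ 'd::finite) set"
  assumes Y: "finite Y" "Y \<noteq> {}"
    and ext: "\<And>w z. (w, z) extreme_point_of hypo Y \<Longrightarrow> z \<le> w \<bullet> y0"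
    and w: "w \<in> weights"
  shows "\<exists>y\<in>Y. w \<bullet> y \<le> w \<bullet> y0"
proof -
  define z where "z = Min ((\<lambda>y. w \<bullet> y) ` Y)"
  \<comment> \<open>The summand \<open>norm y0\<close> puts the cut below all values
    \<open>v \<bullet> y0\<close> at weights \<open>v\<close>; the summand
    \<open>\<bar>z\<bar>\<close> keeps \<open>(w, z)\<close> above the cut.\<close>
  define N where "N = norm y0 + \<bar>z\<bar>"
  define T where "T = hypo Y \<inter> {p. - N \<le> snd p}"
  obtain y1 where y1: "y1 \<in> Y" using Y by blast
  have "snd p \<in> {- N..norm y1}" "fst p \<in> weights" if "p \<in> T" for p
    using that y1 weights_inner_bound[of "fst p" y1] by (auto simp: T_def hypo_def)
  then have "T \<subseteq> weights \<times> {- N..norm y1}" by auto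
  moreover have "closed T"
    unfolding T_def by (intro closed_Int closed_hypo closed_Collect_le continuous_intros)
  moreover have "compact (weights \<times> {- N..norm y1} :: ((real ^ 'd) \<times> real) set)"
    by (intro compact_Times compact_weights) simp
  ultimately have "compact T"
    using closed_Int_compact[of T] by (metis inf.absorb1)
  have "convex {p :: (real ^ 'd) \<times> real. - N \<le> snd p}"
    using convex_halfspace_ge[of "- N" "(0 :: real ^ 'd, 1 :: real)"] by (simp add: inner_prod_def)
  then have "convex T"
    unfolding T_def by (intro convex_Int convex_hypo)
  have T: "T = convex hull {p. p extreme_point_of T}"
    by (rule Krein_Milman_Minkowski) fact+
  have "{p. p extreme_point_of T} \<subseteq> {p. (- y0, 1) \<bullet> p \<le> 0}"
  proof safe
    fix v s assume e: "(v, s) extreme_point_of T"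
    then have v: "(v, s) \<in> T" by (simp add: extreme_point_of_def)
    have "s \<le> v \<bullet> y0"
    proof (cases "- N < s")
      case True
      then show ?thesis using e ext extreme_point_of_Int_above[OF convex_hypo] unfolding T_def by blast
    next
      case False
      moreover have "\<bar>v \<bullet> y0\<bar> \<le> norm y0" using v weights_inner_bound by (auto simp: T_def hypo_def)
      ultimately show ?thesis by (simp add: N_def)
    qed
    then show "(- y0, 1) \<bullet> (v, s) \<le> 0" by (simp add: inner_commute)
  qed
  then have "convex hull {p. p extreme_point_of T} \<subseteq> {p. (- y0, 1) \<bullet> p \<le> 0}"
    by (intro hull_minimal convex_halfspace_le)
  with T have T_le: "T \<subseteq> {p. (- y0, 1) \<bullet> p \<le> 0}" by simp
  have "z \<le> w \<bullet> y" if "y \<in> Y" for y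
    unfolding z_def using that Y by (intro Min_le) auto
  moreover have "- N \<le> z" unfolding N_def using norm_ge_zero[of y0] by linarith
  ultimately have "(w, z) \<in> T" using w by (auto simp: T_def hypo_def)
  with T_le have "z \<le> w \<bullet> y0"
    by (auto simp: inner_commute)
  moreover have "z \<in> (\<lambda>y. w \<bullet> y) ` Y" unfolding z_def using Y by (intro Min_in) auto
  ultimately show ?thesis by auto
qed

text \<open>Otherwise a hyperplane strictly separates the orthant \<open>{..y0}\<close> from the
  compact hull. As the orthant is unbounded downwards in each coordinate, the normal vector is
  nonnegative; normalized, it is a weight for which no \<open>y\<close> in \<open>Y\<close> does as
  well as \<open>y0\<close>.\<close>

lemma convex_hull_dominates:
  fixes Y :: "(real ^ 'd::finite) set"
  assumes Y: "finite Y" "Y \<noteq> {}"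
    and dom: "\<And>w. w \<in> weights \<Longrightarrow> \<exists>y\<in>Y. w \<bullet> y \<le> w \<bullet> y0"
  shows "\<exists>y\<in>convex hull Y. y \<le> y0"
proof (rule ccontr)
  assume "\<not> ?thesis"
  then have disj: "{..y0} \<inter> convex hull Y = {}" by auto
  have "{..y0} = (\<Inter>i. {y. axis i 1 \<bullet> y \<le> y0 $ i})"
    by (auto simp: less_eq_vec_def inner_axis')
  then have "convex {..y0}" by (simp add: convex_INT convex_halfspace_le)
  moreover have "closed {..y0}"
    using \<open>{..y0} = _\<close> by (simp add: closed_INT closed_halfspace_le)
  moreover have "compact (convex hull Y)" using Y by (simp add: compact_convex_hull finite_imp_compact)
  ultimately obtain a b where a: "\<And>y. y \<le> y0 \<Longrightarrow> a \<bullet> y < b" and b: "\<And>y. y \<in> convex hull Y \<Longrightarrow> b < a \<bullet> y"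
    using separating_hyperplane_closed_compact[of "{..y0}" "convex hull Y"] Y disj
    by (metis atMost_iff convex_convex_hull convex_hull_eq_empty)
  have "0 \<le> a $ i" for i
  proof (rule ccontr)
    assume neg: "\<not> 0 \<le> a $ i"
    \<comment> \<open>The distance to walk from \<open>y0\<close> against the \<open>i\<close>-th
      axis until the value of \<open>a\<close> rises to exactly \<open>b\<close>, which contradicts
      the strict separation.\<close>
    define t where "t = (b - a \<bullet> y0) / - (a $ i)"
    have "a \<bullet> y0 < b" using a by simp
    then have "0 < t" using neg by (simp add: t_def divide_pos_neg)
    then have "y0 - t *\<^sub>R axis i 1 \<le> y0" by (auto simp: less_eq_vec_def axis_def)
    then have "a \<bullet> (y0 - t *\<^sub>R axis i 1) < b" by (rule a)
    moreover have "t * a $ i = a \<bullet> y0 - b" using neg by (simp add: t_def)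
    ultimately show False by (simp add: inner_diff_right inner_axis)
  qed
  then have "0 \<le> a" by (simp add: less_eq_vec_def)
  moreover obtain y1 where "y1 \<in> Y" using Y by blast
  then have "a \<noteq> 0" using a[of y0] b[of y1] by (auto simp: hull_inc)
  ultimately have "normalize1 a \<in> weights" "0 < norm1 a"
    by (simp_all add: normalize1_in_weights norm1_pos)
  then obtain y where "y \<in> Y" "a \<bullet> y \<le> a \<bullet> y0"
    using dom[of "normalize1 a"] by (auto simp: normalize1_def divide_le_cancel)
  then show False using a[of y0] b[of y] by (auto simp: hull_inc)
qed

lemma extreme_points_hypo_imp_convex_hull_dominates:
  fixes Y :: "(real ^ 'd::finite) set"
  assumes "finite Y" "Y \<noteq> {}"
    and "\<And>w z. (w, z) extreme_point_of hypo Y \<Longrightarrow> z \<le> w \<bullet> y0"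
  shows "\<exists>y\<in>convex hull Y. y \<le> y0"
  using assms by (intro convex_hull_dominates extreme_points_hypo_dominate)

lemma convex_hull_image_indexed:
  assumes "y \<in> convex hull (f ` S)"
  shows "\<exists>L \<ge> (1::nat). \<exists>x :: nat \<Rightarrow> 'x. \<exists>\<theta> :: nat \<Rightarrow> real.
    (\<forall>l\<in>{1..L}. x l \<in> S \<and> 0 \<le> \<theta> l) \<and> (\<Sum>l=1..L. \<theta> l) = 1 \<and> (\<Sum>l=1..L. \<theta> l *\<^sub>R f (x l)) = y"
proof -
  obtain L u v where uv: "\<And>l. l \<in> {1::nat..L} \<Longrightarrow> 0 \<le> u l \<and> v l \<in> f ` S"
    and u1: "sum u {1..L} = (1::real)" and y: "(\<Sum>l=1..L. u l *\<^sub>R v l) = y"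
    using assms unfolding convex_hull_indexed by blast
  have "1 \<le> L" using u1 by (cases L) auto
  moreover have "\<forall>l\<in>{1..L}. inv_into S f (v l) \<in> S \<and> 0 \<le> u l"
    using uv by (auto intro: inv_into_into)
  moreover have "(\<Sum>l=1..L. u l *\<^sub>R f (inv_into S f (v l))) = y"
    unfolding y[symmetric] using uv by (intro sum.cong) (auto simp: f_inv_into_f)
  ultimately show ?thesis using u1
    by (intro exI[of _ L] exI[of _ "\<lambda>l. inv_into S f (v l)"] exI[of _ u] conjI)
qed

lemma extreme_point_of_linear_image:
  assumes "linear f" "inj f"
  shows "f x extreme_point_of f ` S \<longleftrightarrow> x extreme_point_of S"
  using face_of_linear_image[OF assms, of "{x}" S] by (simp add: face_of_singleton)

text \<open>It suffices to check the finitely many weights at extreme points of D(S): there the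
  scaled vector of \<open>x'\<close> lies on the right side of the graph, and this passes to all
  weights and then to a point of the convex hull of the objective vectors.\<close>

lemma convex_approximation_setI:
  fixes f :: "'x \<Rightarrow> real ^ 'd::finite"
  assumes S: "finite S" "S \<noteq> {}" "S \<subseteq> X" and \<gamma>: "0 < \<gamma>"
    and ext: "\<And>w z. (w, z) extreme_point_of Dset s f S \<Longrightarrow> \<exists>x\<in>S. approximation_for s X f \<gamma> w x"
  shows "convex_approximation_set s X f \<gamma> S"
  unfolding convex_approximation_set_def
proof (intro conjI ballI S)
  fix x' assume x': "x' \<in> X"
  show "\<exists>L \<ge> (1::nat). \<exists>x :: nat \<Rightarrow> 'x. \<exists>\<theta> :: nat \<Rightarrow> real.
        (\<forall>l\<in>{1..L}. x l \<in> S \<and> 0 \<le> \<theta> l) \<and> (\<Sum>l=1..L. \<theta> l) = 1 \<and>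
        (case s of
           Minimize \<Rightarrow> (\<Sum>l=1..L. \<theta> l *\<^sub>R f (x l)) \<le> \<gamma> *\<^sub>R f x'
         | Maximize \<Rightarrow> (\<Sum>l=1..L. \<theta> l *\<^sub>R f (x l)) \<ge> (1 / \<gamma>) *\<^sub>R f x')"
  proof (cases s)
    case Minimize
    have D: "Dset s f S = hypo (f ` S)"
      using S by (auto simp: Dset_def Hset_def hypo_def Minimize)
    have "z \<le> w \<bullet> (\<gamma> *\<^sub>R f x')" if e: "(w, z) extreme_point_of hypo (f ` S)" for w z
    proof -
      obtain x where "x \<in> S" "w \<bullet> f x \<le> \<gamma> * (w \<bullet> f x')"
        using ext[of w z] e x' unfolding D by (auto simp: approximation_for_def Minimize)
      moreover have "z \<le> w \<bullet> f x" using e \<open>x \<in> S\<close> by (auto simp: extreme_point_of_def hypo_def)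
      ultimately show ?thesis by simp
    qed
    then obtain y where "y \<in> convex hull (f ` S)" "y \<le> \<gamma> *\<^sub>R f x'"
      using extreme_points_hypo_imp_convex_hull_dominates[of "f ` S" "\<gamma> *\<^sub>R f x'"] S by auto
    then show ?thesis using convex_hull_image_indexed[of y f S] by (fastforce simp: Minimize)
  next
    case Maximize
    \<comment> \<open>Reflecting the last coordinate turns D(S) for maximization into the region
      below the negated objectives. The map is linear, injective and its own inverse, so extreme
      points correspond.\<close>
    define g where "g = (\<lambda>p :: (real ^ 'd) \<times> real. (fst p, - snd p))"
    have g: "linear g" "inj g"
      by (auto simp: g_def linear_iff inj_def prod_eq_iff)
    have "p \<in> g ` Dset s f S \<longleftrightarrow> p \<in> hypo ((\<lambda>x. - f x) ` S)" for p
    proof -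
      have "p \<in> g ` Dset s f S \<longleftrightarrow> g p \<in> Dset s f S"
        by (auto simp: g_def image_iff prod_eq_iff intro!: bexI[of _ "g p"])
      then show ?thesis using S
        by (cases p) (auto simp: Dset_def Hset_def hypo_def Maximize g_def)
    qed
    then have D: "g ` Dset s f S = hypo ((\<lambda>x. - f x) ` S)" by blast
    have "z \<le> w \<bullet> (- (1 / \<gamma>) *\<^sub>R f x')" if e: "(w, z) extreme_point_of hypo ((\<lambda>x. - f x) ` S)" for w z
    proof -
      have "(w, z) = g (w, - z)" by (simp add: g_def)
      then have "(w, - z) extreme_point_of Dset s f S"
        using e extreme_point_of_linear_image[OF g, of "(w, - z)" "Dset s f S"] unfolding D by simp
      then obtain x where "x \<in> S" "w \<bullet> f x \<ge> 1 / \<gamma> * (w \<bullet> f x')"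
        using ext[of w "- z"] x' by (auto simp: approximation_for_def Maximize)
      moreover have "z \<le> w \<bullet> (- f x)" using e \<open>x \<in> S\<close> by (auto simp: extreme_point_of_def hypo_def)
      ultimately show ?thesis by simp
    qed
    then obtain y where y: "y \<in> convex hull ((\<lambda>x. - f x) ` S)" "y \<le> - (1 / \<gamma>) *\<^sub>R f x'"
      using extreme_points_hypo_imp_convex_hull_dominates[of "(\<lambda>x. - f x) ` S" "- (1 / \<gamma>) *\<^sub>R f x'"] S
      by auto
    then have "- y \<ge> (1 / \<gamma>) *\<^sub>R f x'" by (simp add: le_minus_iff)
    moreover obtain L x \<theta> where "1 \<le> (L::nat)" "\<forall>l\<in>{1..L}. x l \<in> S \<and> 0 \<le> \<theta> l" "(\<Sum>l=1..L. \<theta> l) = 1"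
      "(\<Sum>l=1..L. \<theta> l *\<^sub>R f (x l)) = - y"
      using convex_hull_image_indexed[OF y(1)] by (auto simp: sum_negf)
    ultimately show ?thesis by (auto simp: Maximize intro!: exI[of _ L] exI[of _ x] exI[of _ \<theta>])
  qed
qed

section \<open>Dimension of the polyhedron\<close>

text \<open>The guarantees of the extreme point algorithm are restricted to polyhedra of dimension
  d. D(S) lies in the hyperplane \<open>A\<close> and contains the part of \<open>A\<close> where
  all other inequalities are strict. That part is relatively open, and nonempty because of the
  uniform weight with a sufficiently small, respectively large, last coordinate.\<close>

lemma aff_dim_Dset:
  fixes f :: "'x \<Rightarrow> real ^ 'd::finite"
  assumes S: "finite S" "S \<noteq> {}"
  shows "aff_dim (Dset s f S) = int CARD('d)"
proof -
  define a where "a = ((\<chi> i. 1) :: real ^ 'd, 0 :: real)"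
  define c where "c = (\<lambda>x. case s of Minimize \<Rightarrow> (- f x, 1 :: real) | Maximize \<Rightarrow> (f x, - 1))"
  define U where "U = (\<Inter>i. {p. (- axis i 1, 0) \<bullet> p < 0}) \<inter> (\<Inter>x\<in>S. {p. c x \<bullet> p < 0})"
  define u :: "real ^ 'd" where "u = (\<chi> i. 1 / CARD('d))"
  define A where "A = {p. a \<bullet> p = 1}"
  have "open U" unfolding U_def using S
    by (intro open_Int open_INT ballI open_halfspace_lt) auto
  have inD: "p \<in> Dset s f S" if "p \<in> A" "p \<in> U" for p
  proof -
    have "\<And>i. 0 < fst p $ i" "\<And>x. x \<in> S \<Longrightarrow> c x \<bullet> p < 0" "(\<Sum>i\<in>UNIV. fst p $ i) = 1"
      using that by (auto simp: A_def a_def U_def inner_prod_def inner_axis')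
        (simp add: inner_vec_def)
    then have "fst p \<in> weights" "\<And>x. x \<in> S \<Longrightarrow> c x \<bullet> p < 0"
      by (auto simp: weights_iff less_imp_le)
    then show ?thesis
      by (cases p; cases s) (auto simp: Dset_def Hset_def c_def inner_commute less_imp_le)
  qed
  have "a \<noteq> 0" by (simp add: a_def vec_eq_iff zero_prod_def)
  then have A: "aff_dim A = int CARD('d)" by (simp add: A_def aff_dim_hyperplane)
  have "u \<in> weights" by (simp add: u_def weights_iff)
  define B where "B = (\<Sum>x\<in>S. norm (f x)) + 1"
  have B: "\<bar>u \<bullet> f x\<bar> < B" if "x \<in> S" for x
  proof -
    have "\<bar>u \<bullet> f x\<bar> \<le> norm (f x)" by (rule weights_inner_bound) fact
    also have "\<dots> \<le> (\<Sum>x\<in>S. norm (f x))" using that S by (intro member_le_sum) auto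
    finally show ?thesis by (simp add: B_def)
  qed
  define z where "z = (case s of Minimize \<Rightarrow> - B | Maximize \<Rightarrow> B)"
  have "c x \<bullet> (u, z) < 0" if "x \<in> S" for x
    using B[OF that] by (cases s) (auto simp: c_def z_def inner_commute)
  moreover have "0 < u $ i" for i by (simp add: u_def)
  ultimately have "(u, z) \<in> U" by (auto simp: U_def inner_axis')
  moreover have "(u, z) \<in> A" by (simp add: A_def a_def u_def inner_vec_def)
  ultimately have "A \<inter> U \<noteq> {}" by blast
  then have "aff_dim (A \<inter> U) = int CARD('d)"
    using aff_dim_convex_Int_open[OF _ \<open>open U\<close>, of A] A by (simp add: A_def convex_hyperplane)
  moreover have "A \<inter> U \<subseteq> Dset s f S" using inD by blast
  moreover have "Dset s f S \<subseteq> A"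
    using S by (auto simp: Dset_def Hset_def weights_iff A_def a_def inner_vec_def)
  ultimately show ?thesis using A aff_dim_subset by (metis order_antisym)
qed


section \<open>Boundary rounding\<close>

text \<open>
  Here \<open>v'\<close> arises from \<open>v\<close> by one triggered stage of the boundary rounding of \<open>v0\<close>: the
  entries in \<open>I\<close> are rescaled and stay negligible against those in \<open>J\<close>. If \<open>y'\<close> is nonzero
  somewhere on \<open>J\<close>, that entry absorbs all of \<open>I\<close> at the cost of a factor \<open>1 + e\<close>, directly
  with respect to \<open>v0\<close>; otherwise \<open>y\<close> vanishes on \<open>J\<close> too, and undoing the scaling costs
  nothing. Hence the factor \<open>1 + e\<close> is paid at most once over all stages.
\<close>

lemma transfer_through_scaling:
  fixes v v' v0 y y' :: "'a \<Rightarrow> real"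
  assumes fin: "finite I" "finite J" "I \<inter> J = {}"
    and v: "\<And>i. i \<in> I \<Longrightarrow> 0 \<le> v0 i \<and> v0 i \<le> v' i" "\<And>j. j \<in> J \<Longrightarrow> v j = v0 j \<and> v' j = v0 j"
    and p: "0 < p" "\<And>j. j \<in> J \<Longrightarrow> p \<le> v0 j"
    and small: "sum v' I \<le> c * p"
    and scaled: "(\<exists>s>0. \<forall>i\<in>I. v' i = s * v i) \<or> (\<forall>i\<in>I. v0 i = 0)"
    and y: "\<And>i. i \<in> I \<union> J \<Longrightarrow> y i \<in> {0} \<union> {L..U}" "\<And>i. i \<in> I \<union> J \<Longrightarrow> y' i \<in> {0} \<union> {L..U}"
    and c: "c * \<beta> * U \<le> e * L" "0 < L" "L \<le> U" "1 \<le> \<beta>" "0 < e" "e < 1"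
    and le: "(\<Sum>i\<in>I \<union> J. v' i * y i) \<le> \<beta> * (\<Sum>i\<in>I \<union> J. v' i * y' i)"
  shows "(\<Sum>i\<in>I \<union> J. v i * y i) \<le> \<beta> * (\<Sum>i\<in>I \<union> J. v i * y' i) \<or>
    (\<Sum>i\<in>I \<union> J. v0 i * y i) \<le> (1 + e) * \<beta> * (\<Sum>i\<in>I \<union> J. v0 i * y' i)"
proof -
  have y0: "0 \<le> y i" "0 \<le> y' i" "y' i \<le> U" if "i \<in> I \<union> J" for i
    using y[OF that] c by auto
  have v0: "0 \<le> v0 i" "v0 i \<le> v' i" if "i \<in> I \<union> J" for i
    using that v p by (auto intro: order.trans[OF less_imp_le])
  have v'0: "0 \<le> v' i" if "i \<in> I \<union> J" for i
    using v0(1)[OF that] v0(2)[OF that] by linarith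
  \<comment> \<open>The entries in \<open>I\<close> have total weight at most \<open>c * p\<close>
    and objective values at most \<open>U\<close>. The choice of \<open>c\<close> is such that even
    after multiplication by \<open>\<beta>\<close> they contribute at most the fraction
    \<open>e\<close> of \<open>L * p\<close>, the least contribution of a nonzero value on
    \<open>J\<close>.\<close>
  have "(\<Sum>i\<in>I. v' i * y' i) \<le> (\<Sum>i\<in>I. v' i * U)"
    using y0 v'0 by (intro sum_mono mult_left_mono) auto
  also have "\<dots> \<le> c * p * U"
    using small c by (auto simp flip: sum_distrib_right intro: mult_right_mono)
  finally have "\<beta> * (\<Sum>i\<in>I. v' i * y' i) \<le> \<beta> * (c * p * U)"
    using c by (intro mult_left_mono) auto
  also have "\<dots> = (c * \<beta> * U) * p" by simp
  also have "\<dots> \<le> e * L * p" using c p by (intro mult_right_mono) auto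
  finally have I: "\<beta> * (\<Sum>i\<in>I. v' i * y' i) \<le> e * (L * p)" by (simp add: mult_ac)
  have split: "(\<Sum>i\<in>I \<union> J. g i) = sum g I + sum g J" for g :: "'a \<Rightarrow> real"
    by (rule sum.union_disjoint) (use fin in auto)
  have J: "(\<Sum>i\<in>J. v' i * g i) = (\<Sum>i\<in>J. v0 i * g i)" for g
    using v by (intro sum.cong) auto
  show ?thesis
  proof (cases "\<exists>j\<in>J. y' j \<noteq> 0")
    case True
    then obtain j where j: "j \<in> J" "L \<le> y' j" using y(2) by force
    have "L * p \<le> v0 j * y' j"
      using mult_mono[of p "v0 j" L "y' j"] j p(2)[of j] v0(1)[of j] c by (simp add: mult_ac)
    also have "\<dots> \<le> (\<Sum>i\<in>J. v0 i * y' i)"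
      using j fin y0 v0 by (intro member_le_sum) auto
    also have "\<dots> \<le> (\<Sum>i\<in>I \<union> J. v0 i * y' i)"
      using y0 v0 fin by (intro sum_mono2) auto
    finally have Lp: "L * p \<le> (\<Sum>i\<in>I \<union> J. v0 i * y' i)" (is "_ \<le> ?s") .
    have s: "0 \<le> ?s" using y0 v0 by (intro sum_nonneg) auto
    have "(\<Sum>i\<in>I \<union> J. v0 i * y i) \<le> (\<Sum>i\<in>I \<union> J. v' i * y i)"
      using y0 v0 by (intro sum_mono mult_right_mono) auto
    also have "\<dots> \<le> \<beta> * (\<Sum>i\<in>J. v0 i * y' i) + \<beta> * (\<Sum>i\<in>I. v' i * y' i)"
      using le unfolding split J by (simp add: algebra_simps)
    also have "\<dots> \<le> \<beta> * ?s + e * (L * p)"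
      using I c by (intro add_mono mult_left_mono) (auto intro!: sum_mono2 simp: fin y0 v0)
    also have "\<dots> \<le> \<beta> * ?s + e * (\<beta> * ?s)"
      using Lp c s mult_right_mono[of 1 \<beta> ?s] by (intro add_mono mult_left_mono) auto
    finally show ?thesis by (simp add: algebra_simps)
  next
    case False
    then have y'J: "\<And>j. j \<in> J \<Longrightarrow> y' j = 0" by blast
    \<comment> \<open>A nonzero \<open>y j\<close> alone would contribute \<open>L * p\<close> to
      the left-hand side, while the right-hand side is supported on \<open>I\<close> and is at most
      \<open>e * (L * p)\<close>, which is smaller as \<open>e < 1\<close>.\<close>
    have yJ: "y j = 0" if j: "j \<in> J" for j
    proof (rule ccontr)
      assume "y j \<noteq> 0"
      then have "L \<le> y j" using y(1)[of j] j by auto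
      then have "L * p \<le> v' j * y j"
        using mult_mono[of p "v0 j" L "y j"] p(2)[of j] v0(1)[of j] j c v(2)[OF j]
        by (simp add: mult_ac)
      also have "\<dots> \<le> (\<Sum>i\<in>I \<union> J. v' i * y i)"
        using j fin y0 v'0 by (intro member_le_sum) auto
      also have "\<dots> \<le> \<beta> * (\<Sum>i\<in>I. v' i * y' i)" using le y'J by (simp add: split)
      also note I
      also have "e * (L * p) < 1 * (L * p)" using c p by (intro mult_strict_right_mono) auto
      finally show False by simp
    qed
    show ?thesis
      using scaled
    proof
      assume "\<exists>s>0. \<forall>i\<in>I. v' i = s * v i"
      then obtain s where s: "0 < s" "\<And>i. i \<in> I \<Longrightarrow> v' i = s * v i" by blast
      have scale: "(\<Sum>i\<in>I \<union> J. v' i * g i) = s * (\<Sum>i\<in>I \<union> J. v i * g i)" if "\<And>j. j \<in> J \<Longrightarrow> g j = 0" for g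
        unfolding sum_distrib_left using s that by (intro sum.cong) (auto simp: mult_ac)
      have "s * (\<Sum>i\<in>I \<union> J. v i * y i) \<le> s * (\<beta> * (\<Sum>i\<in>I \<union> J. v i * y' i))"
        using le scale[of y] scale[of y'] yJ y'J by (metis mult.left_commute)
      then show ?thesis using s by simp
    next
      assume "\<forall>i\<in>I. v0 i = 0"
      then have "(\<Sum>i\<in>I \<union> J. v0 i * y i) = 0" using yJ by (intro sum.neutral) auto
      moreover have "0 \<le> (1 + e) * \<beta> * (\<Sum>i\<in>I \<union> J. v0 i * y' i)"
        using c y0 v0 by (intro mult_nonneg_nonneg sum_nonneg) auto
      ultimately show ?thesis by simp
    qed
  qed
qed

text \<open>Loop invariant of the boundary rounding before iteration \<open>n\<close>. The last
  clause always leads back to \<open>v0\<close> with a single factor \<open>1 + e\<close>, so that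
  losses do not multiply: a triggered stage either leads back to \<open>v\<close> at no cost, where
  the induction hypothesis applies, or to \<open>v0\<close> directly.\<close>

lemma boundary_stages:
  fixes v0 :: "nat \<Rightarrow> real"
  assumes v0: "\<And>i. i \<in> {1..d} \<Longrightarrow> 0 \<le> v0 i"
    and sorted: "\<And>i j. 1 \<le> i \<Longrightarrow> i \<le> j \<Longrightarrow> j \<le> d \<Longrightarrow> v0 i \<le> v0 j"
    and c: "0 < c" "c \<le> 1" "c * \<beta> * U \<le> e * L" "0 < L" "L \<le> U" "1 \<le> \<beta>" "0 < e" "e < 1"
    and n: "1 \<le> n" "n \<le> d"
  shows "case fold (boundary_step c) [1..<n] (v0, False, 0) of (v, bool, t) \<Rightarrow>
    (\<forall>i\<in>{1..d}. v0 i \<le> v i) \<and> (\<forall>i\<in>{n..d}. v i = v0 i) \<and>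
    (\<forall>i j. 1 \<le> i \<and> i \<le> j \<and> j \<le> d \<longrightarrow> v i \<le> v j) \<and>
    (\<forall>k\<in>{1..<n}. c * v (k + 1) \<le> (\<Sum>j=1..k. v j)) \<and>
    (\<not> bool \<longrightarrow> v = v0) \<and> t \<le> (n - 1) * (7 * d + 3) \<and>
    (\<forall>y y'. (\<forall>i\<in>{1..d}. y i \<in> {0} \<union> {L..U} \<and> y' i \<in> {0} \<union> {L..U}) \<longrightarrow>
       (\<Sum>i=1..d. v i * y i) \<le> \<beta> * (\<Sum>i=1..d. v i * y' i) \<longrightarrow>
       (\<Sum>i=1..d. v0 i * y i) \<le> (1 + e) * \<beta> * (\<Sum>i=1..d. v0 i * y' i))"
  using n
proof (induction n rule: dec_induct)
  case base
  have "(\<Sum>i=1..d. v0 i * y i) \<le> (1 + e) * \<beta> * (\<Sum>i=1..d. v0 i * y' i)"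
    if y: "\<forall>i\<in>{1..d}. y i \<in> {0} \<union> {L..U} \<and> y' i \<in> {0} \<union> {L..U}"
      and le: "(\<Sum>i=1..d. v0 i * y i) \<le> \<beta> * (\<Sum>i=1..d. v0 i * y' i)" for y y'
  proof -
    have "y' i \<in> {0} \<union> {L..U}" if "i \<in> {1..d}" for i using y that by blast
    then have "0 \<le> y' i" if "i \<in> {1..d}" for i using that c(4) by fastforce
    then have "0 \<le> (\<Sum>i=1..d. v0 i * y' i)" using v0 by (intro sum_nonneg mult_nonneg_nonneg) auto
    then have "\<beta> * (\<Sum>i=1..d. v0 i * y' i) \<le> (1 + e) * \<beta> * (\<Sum>i=1..d. v0 i * y' i)"
      using c by (intro mult_right_mono) auto
    then show ?thesis using le by simp
  qed
  then show ?case using sorted by auto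
next
  case (step n)
  obtain v bool t where fold: "fold (boundary_step c) [1..<n] (v0, False, 0) = (v, bool, t)"
    by (metis prod_cases3)
  define T where "T = (\<lambda>v :: nat \<Rightarrow> real. \<forall>y y'.
      (\<forall>i\<in>{1..d}. y i \<in> {0} \<union> {L..U} \<and> y' i \<in> {0} \<union> {L..U}) \<longrightarrow>
       (\<Sum>i=1..d. v i * y i) \<le> \<beta> * (\<Sum>i=1..d. v i * y' i) \<longrightarrow>
       (\<Sum>i=1..d. v0 i * y i) \<le> (1 + e) * \<beta> * (\<Sum>i=1..d. v0 i * y' i))"
  have fold': "fold (boundary_step c) [1..<Suc n] (v0, False, 0) = boundary_step c n (v, bool, t)"
    using step.hyps fold by simp
  have IH: "\<And>i. i \<in> {1..d} \<Longrightarrow> v0 i \<le> v i" "\<And>i. i \<in> {n..d} \<Longrightarrow> v i = v0 i"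
    "\<And>i j. 1 \<le> i \<Longrightarrow> i \<le> j \<Longrightarrow> j \<le> d \<Longrightarrow> v i \<le> v j"
    "\<And>k. k \<in> {1..<n} \<Longrightarrow> c * v (k + 1) \<le> (\<Sum>j=1..k. v j)"
    "\<not> bool \<Longrightarrow> v = v0" "t \<le> (n - 1) * (7 * d + 3)" "T v"
    using step.IH step.prems unfolding fold T_def by auto
  have n: "1 \<le> n" "n < d" "n + 1 \<in> {1..d}" using step by auto
  have v_nonneg: "0 \<le> v i" if "i \<in> {1..d}" for i using v0 IH(1) that by (meson order.trans)
  \<comment> \<open>A triggered iteration \<open>n\<close> takes
    \<open>(n + 2) + (1 + n + 5 * n) = 7 * n + 3\<close> units.\<close>
  have "t + (7 * d + 3) \<le> (n - 1) * (7 * d + 3) + (7 * d + 3)" using IH(6) by simp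
  also have "\<dots> = (Suc n - 1) * (7 * d + 3)" using n by (cases n) auto
  finally have time: "t + (7 * d + 3) \<le> (Suc n - 1) * (7 * d + 3)" .
  show ?case
  proof (cases "(\<Sum>j=1..n. v j) < c * v (n + 1)")
    case False
    then have "boundary_step c n (v, bool, t) = (v, bool, t + (n + 2))"
      by (simp add: boundary_step_def)
    moreover have "c * v (k + 1) \<le> (\<Sum>j=1..k. v j)" if "k \<in> {1..<Suc n}" for k
      using that IH(4)[of k] False by (cases "k = n") auto
    moreover have "t + (n + 2) \<le> (Suc n - 1) * (7 * d + 3)" using time n by simp
    ultimately show ?thesis using IH unfolding fold' T_def by auto
  next
    case True
    define a where "a = (\<Sum>i=1..n. v i)"
    define v' where "v' = (\<lambda>i. if i \<in> {1..n}
      then (if a > 0 then v i / a * c * v (n + 1) else c / real n * v (n + 1)) else v i)"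
    define p where "p = v (n + 1)"
    have step_eq: "boundary_step c n (v, bool, t) = (v', True, t + (n + 2) + (1 + n + 5 * n))"
      unfolding boundary_step_def v'_def a_def Let_def by (simp only: True split_conv if_True)
    have a: "0 \<le> a" "a < c * p" using v_nonneg n True by (auto simp: a_def p_def intro!: sum_nonneg)
    then have p: "0 < p" using c by (metis order.strict_trans1 zero_less_mult_pos)
    have p0: "p = v0 (n + 1)" using IH(2)[of "n + 1"] n by (simp add: p_def)
    have a0: "v i = 0" if "a = 0" "i \<in> {1..n}" for i
    proof -
      have "\<forall>i\<in>{1..n}. v i = 0"
        using that v_nonneg n unfolding a_def by (subst (asm) sum_nonneg_eq_0_iff) auto
      then show ?thesis using that by blast
    qed
    have v'I: "v' i = (if a > 0 then c * p / a * v i else c * p / real n)" if "i \<in> {1..n}" for i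
      using that by (simp add: v'_def p_def)
    have v'J: "v' i = v i" if "i \<notin> {1..n}" for i using that by (auto simp: v'_def)
    \<comment> \<open>The stage was triggered by \<open>a < c * p\<close>, so the scaling factor
      \<open>c * p / a\<close> exceeds 1; for \<open>a = 0\<close> the old entries are all
      zero.\<close>
    have mono: "v i \<le> v' i" if "i \<in> {1..d}" for i
    proof (cases "i \<in> {1..n}")
      case I: True
      show ?thesis
      proof (cases "a > 0")
        case True
        then have "1 * v i \<le> c * p / a * v i" using a v_nonneg[OF that] by (intro mult_right_mono) auto
        then show ?thesis using v'I[OF I] True by simp
      next
        case False
        then show ?thesis using v'I[OF I] a0[OF _ I] a c p by simp
      qed
    qed (simp add: v'J)
    have v'_nonneg: "0 \<le> v' i" if "i \<in> {1..d}" for i using mono v_nonneg that by (meson order.trans)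
    \<comment> \<open>In both cases the rescaled entries reach the threshold exactly. This yields
      the ratio condition for \<open>k = n\<close> as well as the smallness required for the
      transfer.\<close>
    have sum': "sum v' {1..n} = c * p"
    proof (cases "a > 0")
      case True
      have "sum v' {1..n} = (\<Sum>i=1..n. c * p / a * v i)"
        using True by (intro sum.cong refl) (simp add: v'I)
      also have "\<dots> = c * p / a * a" by (simp only: a_def sum_distrib_left)
      finally show ?thesis using True by simp
    next
      case False
      have "sum v' {1..n} = (\<Sum>i=1..n. c * p / real n)"
        using False by (intro sum.cong refl) (simp add: v'I)
      then show ?thesis using n by simp
    qed
    have v'_le_p: "v' i \<le> p" if "i \<in> {1..n}" for i
    proof -
      have "v' i \<le> sum v' {1..n}" using that v'_nonneg n by (intro member_le_sum) auto
      also have "\<dots> \<le> 1 * p" unfolding sum' using c p by (intro mult_right_mono) auto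
      finally show ?thesis by simp
    qed
    have sorted': "v' i \<le> v' j" if ij: "1 \<le> i" "i \<le> j" "j \<le> d" for i j
    proof -
      consider "j \<le> n" | "i \<le> n" "n < j" | "n < i" by linarith
      then show ?thesis
      proof cases
        case 1
        then show ?thesis using ij IH(3)[OF ij] a c p
          by (auto simp: v'I intro!: mult_left_mono divide_right_mono)
      next
        case 2
        have "p \<le> v j" unfolding p_def using 2 ij by (intro IH(3)) auto
        then show ?thesis using v'_le_p[of i] 2 ij v'J[of j] by simp
      next
        case 3
        then show ?thesis using ij IH(3)[OF ij] by (simp add: v'J)
      qed
    qed
    have ratio: "c * v' (k + 1) \<le> (\<Sum>j=1..k. v' j)" if k: "k \<in> {1..<Suc n}" for k
    proof (cases "k = n")
      case True
      then show ?thesis using sum' v'J[of "n + 1"] by (simp add: p_def)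
    next
      case False
      then have k: "k \<in> {1..<n}" using k by auto
      show ?thesis
      \<comment> \<open>For earlier \<open>k\<close> the condition is invariant under scaling all
        entries by a common factor. For \<open>a = 0\<close> the first \<open>n\<close> entries
        become equal, and \<open>c \<le> 1 \<le> real k\<close> suffices.\<close>
      proof (cases "a > 0")
        case True
        have "c * v' (k + 1) = c * p / a * (c * v (k + 1))" using k True by (simp add: v'I)
        also have "\<dots> \<le> c * p / a * (\<Sum>j=1..k. v j)"
          using IH(4)[OF k] True c p by (intro mult_left_mono) auto
        also have "\<dots> = (\<Sum>j=1..k. v' j)"
          unfolding sum_distrib_left using k True by (intro sum.cong refl) (simp add: v'I)
        finally show ?thesis .
      next
        case False
        have q: "0 \<le> c * p / real n" using c p by simp
        have "c * v' (k + 1) = c * (c * p / real n)" using k False by (simp add: v'I)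
        also have "\<dots> \<le> 1 * (c * p / real n)" using c q by (intro mult_right_mono) auto
        also have "\<dots> \<le> real k * (c * p / real n)" using k q by (intro mult_right_mono) auto
        also have "\<dots> = (\<Sum>j=1..k. c * p / real n)" by simp
        also have "\<dots> = (\<Sum>j=1..k. v' j)" using k False by (intro sum.cong refl) (simp add: v'I)
        finally show ?thesis .
      qed
    qed
    have "T v'"
      unfolding T_def
    proof (intro allI impI)
      fix y y' :: "nat \<Rightarrow> real"
      assume y: "\<forall>i\<in>{1..d}. y i \<in> {0} \<union> {L..U} \<and> y' i \<in> {0} \<union> {L..U}"
        and le: "(\<Sum>i=1..d. v' i * y i) \<le> \<beta> * (\<Sum>i=1..d. v' i * y' i)"
      have IJ: "{1..d} = {1..n} \<union> {n + 1..d}" using n by auto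
      \<comment> \<open>If \<open>a = 0\<close>, the first \<open>n\<close> entries of
        \<open>v\<close> vanish, hence also those of \<open>v0\<close>, which lie between 0 and the
        former.\<close>
      have "(\<exists>s>0. \<forall>i\<in>{1..n}. v' i = s * v i) \<or> (\<forall>i\<in>{1..n}. v0 i = 0)"
      proof (cases "a > 0")
        case True
        then show ?thesis using v'I c p by (intro disjI1 exI[of _ "c * p / a"]) auto
      next
        case False
        then have "v0 i = 0" if "i \<in> {1..n}" for i
          using a0[OF _ that] a IH(1)[of i] v0[of i] that n by force
        then show ?thesis by blast
      qed
      then have "(\<Sum>i=1..d. v i * y i) \<le> \<beta> * (\<Sum>i=1..d. v i * y' i) \<or>
          (\<Sum>i=1..d. v0 i * y i) \<le> (1 + e) * \<beta> * (\<Sum>i=1..d. v0 i * y' i)"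
        using y le c p n sum' unfolding IJ
        by (intro transfer_through_scaling[where p = p and c = c and L = L and U = U and v' = v'])
          (auto simp: p0 IH(2) v'J intro: v0 sorted order.trans[OF IH(1) mono])
      then show "(\<Sum>i=1..d. v0 i * y i) \<le> (1 + e) * \<beta> * (\<Sum>i=1..d. v0 i * y' i)"
        using IH(7) y unfolding T_def by blast
    qed
    moreover have "t + (n + 2) + (1 + n + 5 * n) \<le> (Suc n - 1) * (7 * d + 3)" using time n by simp
    moreover have "\<forall>i\<in>{1..d}. v0 i \<le> v' i" using IH(1) mono by (meson order.trans)
    moreover have "\<forall>i\<in>{Suc n..d}. v' i = v0 i" using IH(2) v'J by simp
    ultimately show ?thesis using sorted' ratio unfolding fold' step_eq T_def by simp
  qed
qed

text \<open>In a sorted sequence the ratio condition gives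
  \<open>c * v (k + 1) \<le> k * v k\<close>. Multiplying these inequalities bounds
  \<open>c ^ (d - 1) * v d\<close> by \<open>fact (d - 1) * v 1\<close>; the total is at most
  \<open>d * v d\<close>, which supplies the remaining factor of \<open>fact d\<close>.\<close>

lemma chain_ratio_bound:
  fixes v :: "nat \<Rightarrow> real"
  assumes sorted: "\<And>i j. 1 \<le> i \<Longrightarrow> i \<le> j \<Longrightarrow> j \<le> d \<Longrightarrow> v i \<le> v j"
    and ratio: "\<And>k. k \<in> {1..<d} \<Longrightarrow> c * v (k + 1) \<le> (\<Sum>j=1..k. v j)"
    and c: "0 < c" and i: "i \<in> {1..d}"
  shows "weight_lb d c * (\<Sum>j=1..d. v j) \<le> v i"
proof -
  have chain: "c ^ (k - 1) * v k \<le> fact (k - 1) * v 1" if "1 \<le> k" "k \<le> d" for k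
    using that
  proof (induction k rule: dec_induct)
    case (step k)
    have "(\<Sum>j=1..k. v j) \<le> real k * v k"
      using sum_bounded_above[of "{1..k}" v "v k"] sorted step by auto
    then have "c * v (k + 1) \<le> real k * v k" using ratio[of k] step by fastforce
    then have "c ^ (k - 1) * (c * v (k + 1)) \<le> c ^ (k - 1) * (real k * v k)"
      using c by (intro mult_left_mono) auto
    also have "\<dots> = real k * (c ^ (k - 1) * v k)" by simp
    also have "\<dots> \<le> real k * (fact (k - 1) * v 1)"
      using step by (intro mult_left_mono) auto
    also have "\<dots> = fact k * v 1" using step by (cases k) (auto simp: algebra_simps)
    finally show ?case using step by (cases k) (auto simp: algebra_simps)
  qed simp
  have "(\<Sum>j=1..d. v j) \<le> real d * v d"
    using sum_bounded_above[of "{1..d}" v "v d"] sorted by auto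
  then have "c ^ (d - 1) * (\<Sum>j=1..d. v j) \<le> c ^ (d - 1) * (real d * v d)"
    using c by (intro mult_left_mono) auto
  also have "\<dots> = real d * (c ^ (d - 1) * v d)" by simp
  also have "\<dots> \<le> real d * (fact (d - 1) * v 1)"
    using chain[of d] i by (intro mult_left_mono) auto
  also have "\<dots> = fact d * v 1" using i by (cases d) (auto simp: algebra_simps)
  also have "\<dots> \<le> fact d * v i" using sorted[of 1 i] i by (intro mult_left_mono) auto
  finally show ?thesis by (simp add: weight_lb_def field_simps)
qed

text \<open>The loop invariants carry over from the sorted sequence to weight vectors: inner
  products and sums are reindexed by the sorting permutation, and normalization scales both sides of
  each inequality alike.\<close>

lemma boundary_rounding_properties:
  fixes w :: "real ^ 'd::finite"
  assumes w: "w \<in> weights" and srt: "sorts (srt w) w"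
    and c: "0 < c" "c \<le> 1" "c * \<beta> * U \<le> e * L" "0 < L" "L \<le> U" "1 \<le> \<beta>" "0 < e" "e < 1"
    and eq: "boundary_rounding srt c w = ((w', bool), t)"
  shows "w' \<in> weights" and "\<And>i. weight_lb CARD('d) c \<le> w' $ i" and "\<not> bool \<Longrightarrow> w' = w"
    and "\<And>y y'. (\<And>i. y $ i \<in> {0} \<union> {L..U}) \<Longrightarrow> (\<And>i. y' $ i \<in> {0} \<union> {L..U}) \<Longrightarrow>
      w' \<bullet> y \<le> \<beta> * (w' \<bullet> y') \<Longrightarrow> w \<bullet> y \<le> (1 + e) * \<beta> * (w \<bullet> y')"
    and "t \<le> 15 * CARD('d) ^ 2"
proof -
  define d where "d = CARD('d)"
  define \<sigma> where "\<sigma> = srt w"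
  define v0 where "v0 = (\<lambda>i. w $ \<sigma> i)"
  have d: "1 \<le> d" by (simp add: d_def Suc_le_eq)
  have bij: "bij_betw \<sigma> {1..d} UNIV" and sorted: "\<And>i j. 1 \<le> i \<Longrightarrow> i \<le> j \<Longrightarrow> j \<le> d \<Longrightarrow> v0 i \<le> v0 j"
    using srt by (auto simp: sorts_def \<sigma>_def d_def v0_def)
  have w_nonneg: "\<And>i. 0 \<le> w $ i" using w by (simp add: weights_iff)
  obtain v b s where fold: "fold (boundary_step c) [1..<d] (v0, False, 0) = (v, b, s)"
    by (metis prod_cases3)
  have stages: "\<And>i. i \<in> {1..d} \<Longrightarrow> v0 i \<le> v i"
    "\<And>i j. 1 \<le> i \<Longrightarrow> i \<le> j \<Longrightarrow> j \<le> d \<Longrightarrow> v i \<le> v j"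
    "\<And>k. k \<in> {1..<d} \<Longrightarrow> c * v (k + 1) \<le> (\<Sum>j=1..k. v j)"
    "\<not> b \<Longrightarrow> v = v0" "s \<le> (d - 1) * (7 * d + 3)"
    "\<And>y y'. (\<And>i. i \<in> {1..d} \<Longrightarrow> y i \<in> {0} \<union> {L..U} \<and> y' i \<in> {0} \<union> {L..U}) \<Longrightarrow>
       (\<Sum>i=1..d. v i * y i) \<le> \<beta> * (\<Sum>i=1..d. v i * y' i) \<Longrightarrow>
       (\<Sum>i=1..d. v0 i * y i) \<le> (1 + e) * \<beta> * (\<Sum>i=1..d. v0 i * y' i)"
    using boundary_stages[of d v0, OF _ sorted c d order.refl] w_nonneg
    unfolding fold by (auto simp: v0_def)
  define u :: "real ^ 'd" where "u = (\<chi> i. v (inv_into {1..d} \<sigma> i))"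
  have u\<sigma>: "u $ \<sigma> j = v j" if "j \<in> {1..d}" for j
    using that bij by (simp add: u_def bij_betw_inv_into_left)
  have sum_\<sigma>: "(\<Sum>i\<in>UNIV. g i) = (\<Sum>j=1..d. g (\<sigma> j))" for g :: "'d \<Rightarrow> real"
    using sum.reindex_bij_betw[OF bij, of g] by simp
  have u_inner: "u \<bullet> y = (\<Sum>j=1..d. v j * y $ \<sigma> j)" for y
    unfolding inner_vec_def sum_\<sigma> using u\<sigma> by (intro sum.cong) auto
  have w_inner: "w \<bullet> y = (\<Sum>j=1..d. v0 j * y $ \<sigma> j)" for y
    unfolding inner_vec_def sum_\<sigma> by (simp add: v0_def)
  have w_le_u: "w $ i \<le> u $ i" for i
  proof -
    obtain j where "j \<in> {1..d}" "i = \<sigma> j"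
      using bij by (metis UNIV_I bij_betw_imp_surj_on image_iff)
    then show ?thesis using stages(1)[of j] u\<sigma> by (simp add: v0_def)
  qed
  have u_nonneg: "0 \<le> u" using w_nonneg w_le_u by (auto simp: less_eq_vec_def intro: order.trans)
  have "w \<noteq> 0" using w by (auto simp: weights_iff)
  then obtain i where "0 < w $ i" using w_nonneg by (auto simp: vec_eq_iff order_less_le)
  then have "u \<noteq> 0" using w_le_u[of i] by auto
  have w': "w' = normalize1 u" and b: "bool = b" and t: "t = d ^ 2 + d + s + d + 2 * d"
    using eq fold by (auto simp: boundary_rounding_def \<sigma>_def u_def d_def v0_def Let_def)
  show "w' \<in> weights" unfolding w' by (rule normalize1_in_weights) fact+
  have n: "0 < norm1 u" "norm1 u = (\<Sum>j=1..d. v j)"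
  proof -
    show "0 < norm1 u" by (rule norm1_pos) fact+
    show "norm1 u = (\<Sum>j=1..d. v j)"
      unfolding norm1_nonneg_eq[OF u_nonneg] sum_\<sigma> using u\<sigma> by (intro sum.cong) auto
  qed
  show "weight_lb CARD('d) c \<le> w' $ i" for i
  proof -
    obtain j where "j \<in> {1..d}" "i = \<sigma> j"
      using bij by (metis UNIV_I bij_betw_imp_surj_on image_iff)
    then have "weight_lb d c * norm1 u \<le> u $ i"
      using chain_ratio_bound[where d = d, OF stages(2,3) c(1), of j] u\<sigma> n(2) by simp
    then show ?thesis using n(1) by (simp add: w' normalize1_def d_def field_simps)
  qed
  show "w' = w" if "\<not> bool"
  proof -
    have "v = v0" using that b stages(4) by simp
    then have "u = w"
      using bij by (auto simp: u_def v0_def vec_eq_iff bij_betw_inv_into_right)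
    then show ?thesis using w' normalize1_weights[OF w] by simp
  qed
  show "w \<bullet> y \<le> (1 + e) * \<beta> * (w \<bullet> y')"
    if "\<And>i. y $ i \<in> {0} \<union> {L..U}" "\<And>i. y' $ i \<in> {0} \<union> {L..U}" "w' \<bullet> y \<le> \<beta> * (w' \<bullet> y')" for y y'
  proof -
    have "u \<bullet> y \<le> \<beta> * (u \<bullet> y')"
      using that(3) n(1) by (simp add: w' normalize1_def divide_le_cancel)
    then show ?thesis
      unfolding u_inner w_inner by (intro stages(6)) (use that in auto)
  qed
  show "t \<le> 15 * CARD('d) ^ 2"
  proof -
    \<comment> \<open>Together with \<open>d ^ 2 + 4 * d\<close> units outside the loop this gives
      \<open>8 * d ^ 2 + 7 * d\<close>, and \<open>d \<ge> 1\<close> turns it into a multiple of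
      \<open>d ^ 2\<close>.\<close>
    have "s \<le> d * (7 * d + 3)" using stages(5) by (rule order.trans) simp
    then have "t \<le> 8 * (d * d) + 7 * d" by (simp add: t power2_eq_square algebra_simps)
    also have "\<dots> \<le> 15 * d ^ 2" using d by (simp add: power2_eq_square)
    finally show ?thesis by (simp add: d_def)
  qed
qed


section \<open>The grid\<close>

lemma eps'_properties:
  assumes "0 < \<epsilon>" "\<epsilon> < 1"
  shows "0 < eps' \<epsilon>" "eps' \<epsilon> < 1" "(1 + eps' \<epsilon>) ^ 2 = 1 + \<epsilon>"
proof -
  show "0 < eps' \<epsilon>" using assms by (simp add: eps'_def)
  have "sqrt (1 + \<epsilon>) < sqrt 4" using assms by (intro real_sqrt_less_mono) simp
  then show "eps' \<epsilon> < 1" by (simp add: eps'_def)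
  show "(1 + eps' \<epsilon>) ^ 2 = 1 + \<epsilon>" using assms by (simp add: eps'_def)
qed

text \<open>The equation is what lets negligible weights be absorbed at the cost of a factor
  \<open>1 + eps' \<epsilon>\<close>. The bound
  \<open>eps' \<epsilon> / (1 + eps' \<epsilon>)\<close> follows from
  \<open>\<alpha> \<ge> 1\<close> and \<open>L \<le> U\<close> and controls the upper end of the
  exponent range of the grid.\<close>

lemma ratio_c_properties:
  assumes \<epsilon>: "0 < \<epsilon>" "\<epsilon> < 1" and "1 \<le> \<alpha>" "0 < L" "L \<le> U"
  shows "0 < ratio_c \<epsilon> \<alpha> (L, U)"
    and "ratio_c \<epsilon> \<alpha> (L, U) * ((1 + eps' \<epsilon>) * \<alpha>) * U = eps' \<epsilon> * L"
    and "ratio_c \<epsilon> \<alpha> (L, U) \<le> eps' \<epsilon> / (1 + eps' \<epsilon>)" and "ratio_c \<epsilon> \<alpha> (L, U) \<le> 1"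
proof -
  note e = eps'_properties[OF \<epsilon>]
  have \<beta>: "1 + eps' \<epsilon> \<le> (1 + eps' \<epsilon>) * \<alpha>" using assms e by simp
  then show "0 < ratio_c \<epsilon> \<alpha> (L, U)" "ratio_c \<epsilon> \<alpha> (L, U) * ((1 + eps' \<epsilon>) * \<alpha>) * U = eps' \<epsilon> * L"
    using assms e by (auto simp: ratio_c_def Let_def)
  have "ratio_c \<epsilon> \<alpha> (L, U) = eps' \<epsilon> / ((1 + eps' \<epsilon>) * \<alpha>) * (L / U)"
    by (simp add: ratio_c_def Let_def)
  also have "\<dots> \<le> eps' \<epsilon> / ((1 + eps' \<epsilon>) * \<alpha>) * 1"
    using assms e by (intro mult_left_mono) auto
  also have "\<dots> \<le> eps' \<epsilon> / (1 + eps' \<epsilon>)" using \<beta> e by (simp add: frac_le)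
  finally show c: "ratio_c \<epsilon> \<alpha> (L, U) \<le> eps' \<epsilon> / (1 + eps' \<epsilon>)" .
  also have "\<dots> \<le> 1" using e by simp
  finally show "ratio_c \<epsilon> \<alpha> (L, U) \<le> 1" .
qed

lemma weight_lb_bounds:
  assumes "0 < c" "c \<le> 1"
  shows "0 < weight_lb d c" "weight_lb d c \<le> 1" "0 < d \<Longrightarrow> (real d - 1) * weight_lb d c \<le> c"
proof -
  show "0 < weight_lb d c" using assms by (simp add: weight_lb_def)
  have "c ^ (d - 1) \<le> 1" using assms by (simp add: power_le_one)
  moreover have "1 \<le> (fact d :: real)" by (rule fact_ge_1)
  ultimately have "c ^ (d - 1) \<le> fact d" by (rule order.trans)
  then show "weight_lb d c \<le> 1" by (simp add: weight_lb_def)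
  show "(real d - 1) * weight_lb d c \<le> c" if "0 < d"
  proof (cases "d = 1")
    case False
    then have "d = Suc (Suc (d - 2))" using that by simp
    then obtain k where d: "d = Suc (Suc k)" ..
    have "c ^ Suc k \<le> c" using assms by (simp add: power_le_one mult_left_le)
    moreover have "(real d - 1) / fact d \<le> 1"
    proof -
      have "real d - 1 \<le> real d" by simp
      also have "\<dots> \<le> real (fact d)" unfolding of_nat_le_iff by (rule fact_ge_self)
      finally show ?thesis by simp
    qed
    ultimately have "(real d - 1) / fact d * c ^ Suc k \<le> 1 * c"
      using assms by (intro mult_mono) auto
    then show ?thesis by (simp add: weight_lb_def d)
  qed (use assms in simp)
qed

text \<open>
  The exponents of rounded weights are never positive, and the upper bound on the exponents of
  the grid is nonnegative because of the choice of \<open>c\<close>. This also covers rounding with the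
  larger factor \<open>1 + \<epsilon> = (1 + eps' \<epsilon>)\<^sup>2\<close>.
\<close>

lemma grid_memberI:
  fixes a :: "'d::finite \<Rightarrow> int"
  assumes \<epsilon>: "0 < \<epsilon>" "\<epsilon> < 1" and \<alpha>: "1 \<le> \<alpha>" "0 < L" "L \<le> U"
    and a: "\<And>i. log (1 + eps' \<epsilon>) (weight_lb CARD('d) (ratio_c \<epsilon> \<alpha> (L, U))) \<le> a i" "\<And>i. a i \<le> 0"
  shows "normalize1 (\<chi> i. (1 + eps' \<epsilon>) powi a i) \<in> grid \<epsilon> \<alpha> (L, U)"
proof -
  let ?e = "eps' \<epsilon>" and ?c = "ratio_c \<epsilon> \<alpha> (L, U)"
  note e = eps'_properties[OF \<epsilon>] and c = ratio_c_properties[OF \<epsilon> \<alpha>]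
  have "(real CARD('d) - 1) * weight_lb CARD('d) ?c \<le> ?e / (1 + ?e)"
    using weight_lb_bounds(3)[OF c(1,4), of "CARD('d)"] c(3) by simp
  \<comment> \<open>The complement of \<open>?e / (1 + ?e)\<close> is \<open>1 / (1 + ?e)\<close>,
    whose logarithm -1 is cancelled by the summand 1 in the upper exponent bound.\<close>
  then have le: "1 / (1 + ?e) \<le> 1 - (real CARD('d) - 1) * weight_lb CARD('d) ?c" (is "_ \<le> ?u")
    using e by (simp add: field_simps)
  moreover have "0 < 1 / (1 + ?e)" using e by simp
  ultimately have "0 < ?u" by linarith
  then have "log (1 + ?e) (1 / (1 + ?e)) \<le> log (1 + ?e) ?u"
    using e le by (subst log_le_cancel_iff) auto
  moreover have "log (1 + ?e) (1 / (1 + ?e)) = - 1" using e by (simp add: log_divide)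
  moreover have "real_of_int (a i) \<le> 0" for i using a(2)[of i] by simp
  ultimately have u: "real_of_int (a i) \<le> log (1 + ?e) ?u + 1" for i
    by (smt (verit))
  show ?thesis
    unfolding grid_def Let_def using a(1) u by blast
qed

lemma finite_grid: "finite (grid \<epsilon> \<alpha> b :: (real ^ 'd::finite) set)"
proof -
  define l where "l = weight_lb CARD('d) (ratio_c \<epsilon> \<alpha> b)"
  define A where "A = {\<lceil>log (1 + eps' \<epsilon>) l\<rceil>..\<lfloor>log (1 + eps' \<epsilon>) (1 - (real CARD('d) - 1) * l) + 1\<rfloor>}"
  have "finite (PiE (UNIV :: 'd set) (\<lambda>_. A))" by (intro finite_PiE) (auto simp: A_def)
  moreover have "grid \<epsilon> \<alpha> b \<subseteq> (\<lambda>a. normalize1 (\<chi> i. (1 + eps' \<epsilon>) powi a i)) ` PiE (UNIV :: 'd set) (\<lambda>_. A)"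
  proof
    fix g :: "real ^ 'd" assume "g \<in> grid \<epsilon> \<alpha> b"
    then obtain a where g: "g = normalize1 (\<chi> i. (1 + eps' \<epsilon>) powi a i)"
      and a: "\<And>i. log (1 + eps' \<epsilon>) l \<le> real_of_int (a i)"
        "\<And>i. real_of_int (a i) \<le> log (1 + eps' \<epsilon>) (1 - (real CARD('d) - 1) * l) + 1"
      unfolding grid_def Let_def l_def by blast
    have "a i \<in> A" for i unfolding A_def atLeastAtMost_iff ceiling_le_iff le_floor_iff using a by blast
    then show "g \<in> (\<lambda>a. normalize1 (\<chi> i. (1 + eps' \<epsilon>) powi a i)) ` PiE (UNIV :: 'd set) (\<lambda>_. A)"
      unfolding g by (intro imageI) auto
  qed
  ultimately show ?thesis by (meson finite_imageI finite_subset)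
qed

text \<open>All exponents are 0. This is the first weight entered into \<open>R\<close>; it also
  shows that the grid is nonempty.\<close>

lemma uniform_in_grid:
  assumes \<epsilon>: "0 < \<epsilon>" "\<epsilon> < 1" and \<alpha>: "1 \<le> \<alpha>" "0 < L" "L \<le> U"
  shows "(\<chi> i. 1 / real CARD('d)) \<in> (grid \<epsilon> \<alpha> (L, U) :: (real ^ 'd::finite) set)"
proof -
  let ?l = "weight_lb CARD('d) (ratio_c \<epsilon> \<alpha> (L, U))"
  note e = eps'_properties[OF \<epsilon>] and c = ratio_c_properties[OF \<epsilon> \<alpha>]
  have "normalize1 (\<chi> i. (1 + eps' \<epsilon>) powi (0 :: int)) \<in> (grid \<epsilon> \<alpha> (L, U) :: (real ^ 'd) set)"
    using weight_lb_bounds(1,2)[OF c(1,4), of "CARD('d)"] e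
    by (intro grid_memberI[OF \<epsilon> \<alpha>]) auto
  moreover have "normalize1 (\<chi> i. (1 + eps' \<epsilon>) powi (0 :: int)) = (\<chi> i. 1 / real CARD('d) :: real ^ 'd)"
    by (simp add: normalize1_def norm1_def vec_eq_iff)
  ultimately show ?thesis by simp
qed

lemma grid_subset_weights:
  assumes "0 < \<epsilon>"
  shows "grid \<epsilon> \<alpha> b \<subseteq> (weights :: (real ^ 'd::finite) set)"
proof -
  have "0 < 1 + eps' \<epsilon>" using assms by (simp add: eps'_def)
  then have pos: "0 < (1 + eps' \<epsilon>) powi k" for k by (rule zero_less_power_int)
  have "normalize1 (\<chi> i. (1 + eps' \<epsilon>) powi a i :: real ^ 'd) \<in> weights" for a
  proof (rule normalize1_in_weights)
    show "0 \<le> (\<chi> i. (1 + eps' \<epsilon>) powi a i :: real ^ 'd)"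
      using pos by (simp add: less_eq_vec_def less_imp_le)
    show "(\<chi> i. (1 + eps' \<epsilon>) powi a i :: real ^ 'd) \<noteq> 0"
      using less_imp_neq[OF pos[of "a undefined"]] by (auto simp: vec_eq_iff simp del: power_int_eq_0_iff)
  qed
  then show ?thesis by (auto simp: grid_def Let_def)
qed

text \<open>For a single objective the only weight is 1. The running time bound relies on this,
  since for d = 1 its exponent is too small to dominate a quadratic term.\<close>

lemma card_grid_le_1:
  assumes "0 < \<epsilon>" "CARD('d::finite) = 1"
  shows "card (grid \<epsilon> \<alpha> b :: (real ^ 'd) set) \<le> 1"
proof -
  obtain k :: 'd where k: "UNIV = {k}" using assms(2) by (rule card_1_singletonE)
  have "w $ i = 1" if "w \<in> weights" for w :: "real ^ 'd" and i
  proof -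
    have "i = k" using k by blast
    then show ?thesis using that by (simp add: weights_iff k)
  qed
  then have "grid \<epsilon> \<alpha> b \<subseteq> {\<chi> i. 1 :: real ^ 'd}"
    using grid_subset_weights[OF assms(1)] by (fastforce simp: vec_eq_iff)
  then have "card (grid \<epsilon> \<alpha> b :: (real ^ 'd) set) \<le> card {\<chi> i. 1 :: real ^ 'd}"
    by (intro card_mono) auto
  then show ?thesis by simp
qed

section \<open>Rounding to the grid\<close>

lemma grid_rounding_bounds:
  assumes "0 < \<delta>" "0 < (x :: real)"
  shows "x \<le> (1 + \<delta>) powi \<lceil>log (1 + \<delta>) x\<rceil>" "(1 + \<delta>) powi \<lceil>log (1 + \<delta>) x\<rceil> \<le> (1 + \<delta>) * x"
proof -
  have powi: "(1 + \<delta>) powi k = (1 + \<delta>) powr real_of_int k" for k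
    using assms by (simp add: powr_real_of_int')
  have "x = (1 + \<delta>) powr log (1 + \<delta>) x" using assms by simp
  also have "\<dots> \<le> (1 + \<delta>) powi \<lceil>log (1 + \<delta>) x\<rceil>"
    unfolding powi using assms by (intro powr_mono le_of_int_ceiling) simp
  finally show "x \<le> (1 + \<delta>) powi \<lceil>log (1 + \<delta>) x\<rceil>" .
  have "(1 + \<delta>) powi \<lceil>log (1 + \<delta>) x\<rceil> \<le> (1 + \<delta>) powr (1 + log (1 + \<delta>) x)"
  proof (unfold powi, rule powr_mono)
    show "real_of_int \<lceil>log (1 + \<delta>) x\<rceil> \<le> 1 + log (1 + \<delta>) x"
      using of_int_ceiling_le_add_one[of "log (1 + \<delta>) x"] by linarith
  qed (use assms in simp)
  also have "\<dots> = (1 + \<delta>) * x" using assms by (simp add: powr_add)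
  finally show "(1 + \<delta>) powi \<lceil>log (1 + \<delta>) x\<rceil> \<le> (1 + \<delta>) * x" .
qed

text \<open>Before normalization each entry grows by a factor between 1 and
  \<open>1 + \<delta>\<close>, so only the right-hand side of the inequality loses
  \<open>1 + \<delta>\<close>; normalization cancels.\<close>

lemma grid_rounding_approximates:
  fixes w y y' :: "real ^ 'd::finite"
  assumes \<delta>: "0 < \<delta>" and w: "\<And>i. 0 < w $ i" and y: "0 \<le> y" "0 \<le> y'" and \<alpha>: "0 \<le> \<alpha>"
    and le: "result (grid_rounding \<delta> w) \<bullet> y \<le> \<alpha> * (result (grid_rounding \<delta> w) \<bullet> y')"
  shows "w \<bullet> y \<le> (1 + \<delta>) * \<alpha> * (w \<bullet> y')"
proof -
  define u :: "real ^ 'd" where "u = (\<chi> i. (1 + \<delta>) powi \<lceil>log (1 + \<delta>) (w $ i)\<rceil>)"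
  have u: "w $ i \<le> u $ i" "u $ i \<le> (1 + \<delta>) * w $ i" for i
    using grid_rounding_bounds[OF \<delta> w] by (auto simp: u_def)
  have "0 < u $ i" for i using u(1)[of i] w[of i] by linarith
  then have "0 \<le> u" "u \<noteq> 0"
    by (auto simp: less_eq_vec_def less_imp_le dest: spec[of _ undefined])
  then have "0 < norm1 u" by (rule norm1_pos)
  then have "u \<bullet> y \<le> \<alpha> * (u \<bullet> y')"
    using le by (simp add: grid_rounding_def normalize1_def divide_le_cancel flip: u_def)
  moreover have "w \<bullet> y \<le> u \<bullet> y"
    using u y unfolding inner_vec_def by (intro sum_mono) (auto simp: less_eq_vec_def intro: mult_right_mono)
  moreover have "u \<bullet> y' \<le> (1 + \<delta>) * (w \<bullet> y')"
    using u y unfolding inner_vec_def sum_distrib_left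
    by (intro sum_mono) (auto simp: less_eq_vec_def simp flip: mult.assoc intro: mult_right_mono)
  then have "\<alpha> * (u \<bullet> y') \<le> \<alpha> * ((1 + \<delta>) * (w \<bullet> y'))" using \<alpha> by (rule mult_left_mono)
  ultimately show ?thesis by (simp add: mult_ac)
qed

lemma grid_rounding_in_grid:
  fixes w :: "real ^ 'd::finite"
  assumes \<epsilon>: "0 < \<epsilon>" "\<epsilon> < 1" and \<alpha>: "1 \<le> \<alpha>" "0 < L" "L \<le> U"
    and w: "w \<in> weights" "\<And>i. weight_lb CARD('d) (ratio_c \<epsilon> \<alpha> (L, U)) \<le> w $ i"
    and \<delta>: "\<delta> = eps' \<epsilon> \<or> \<delta> = \<epsilon>"
  shows "result (grid_rounding \<delta> w) \<in> grid \<epsilon> \<alpha> (L, U)"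
proof -
  let ?e = "eps' \<epsilon>" and ?l = "weight_lb CARD('d) (ratio_c \<epsilon> \<alpha> (L, U))"
  note e = eps'_properties[OF \<epsilon>] and c = ratio_c_properties[OF \<epsilon> \<alpha>]
  have l: "0 < ?l" using weight_lb_bounds(1)[OF c(1,4)] .
  have "w $ i \<le> 1" for i
    using member_le_sum[of i UNIV "($) w"] w(1) by (simp add: weights_iff)
  moreover have "0 < w $ i" for i using l w(2)[of i] by linarith
  ultimately have w1: "0 < w $ i" "w $ i \<le> 1" for i by auto
  have lw: "log (1 + ?e) ?l \<le> log (1 + ?e) (w $ i)" for i
    using e l w(2)[of i] w1(1)[of i] by (subst log_le_cancel_iff) auto
  \<comment> \<open>\<open>k\<close> is 1 for \<open>eps' \<epsilon>\<close> and 2 for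
    \<open>\<epsilon>\<close>, so powers of \<open>1 + \<delta>\<close> are powers of
    \<open>1 + eps' \<epsilon>\<close> with exponents multiplied by \<open>k\<close>.\<close>
  obtain k :: nat where k: "1 + \<delta> = (1 + ?e) ^ k" "0 < k"
    using \<delta> e(3) by (metis power_one_right zero_less_numeral zero_less_one)
  have \<delta>pos: "0 < \<delta>" using \<delta> \<epsilon> e by auto
  have "(\<chi> i. (1 + \<delta>) powi \<lceil>log (1 + \<delta>) (w $ i)\<rceil>) = (\<chi> i. (1 + ?e) powi (int k * \<lceil>log (1 + \<delta>) (w $ i)\<rceil>))"
    unfolding k(1) by (simp add: power_int_mult)
  moreover have "log (1 + ?e) ?l \<le> real_of_int (int k * \<lceil>log (1 + \<delta>) (w $ i)\<rceil>)" for i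
  proof -
    have "log (1 + ?e) (w $ i) = real k * log (1 + \<delta>) (w $ i)"
      unfolding k(1) using k(2) e by (simp add: log_base_pow)
    also have "\<dots> \<le> real k * real_of_int \<lceil>log (1 + \<delta>) (w $ i)\<rceil>"
      by (intro mult_left_mono) auto
    finally show ?thesis using lw[of i] by simp
  qed
  moreover have "int k * \<lceil>log (1 + \<delta>) (w $ i)\<rceil> \<le> 0" for i
    using w1[of i] \<delta>pos by (intro mult_nonneg_nonpos) (auto simp: ceiling_le_iff)
  ultimately show ?thesis
    unfolding grid_rounding_def
    using grid_memberI[OF \<epsilon> \<alpha>, where a = "\<lambda>i. int k * \<lceil>log (1 + \<delta>) (w $ i)\<rceil>"] by simp
qed


section \<open>The algorithm\<close>

definition oaa_rounding ::
  "(real ^ 'd \<Rightarrow> nat \<Rightarrow> 'd) \<Rightarrow> real \<Rightarrow> real \<Rightarrow> real \<times> real \<Rightarrow> real ^ 'd::finite \<Rightarrow> (real ^ 'd) timed" where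
  "oaa_rounding srt \<epsilon> \<alpha> b w =
     (let ((w', bool), t') = boundary_rounding srt (ratio_c \<epsilon> \<alpha> b) w;
          (w'', t'') = (if bool then grid_rounding (eps' \<epsilon>) w' else grid_rounding \<epsilon> w')
      in (w'', t' + t''))"

text \<open>If the flag is set, both roundings lose \<open>1 + eps' \<epsilon>\<close>, and the
  product is \<open>1 + \<epsilon>\<close>. If not, the boundary rounding has left \<open>w\<close>
  unchanged and the grid rounding may use the whole factor. The time is 15 \<open>d ^ 2\<close> for
  the first and 6 \<open>d\<close> for the second rounding.\<close>

lemma oaa_rounding_properties:
  fixes w :: "real ^ 'd::finite"
  assumes \<epsilon>: "0 < \<epsilon>" "\<epsilon> < 1" and \<alpha>: "1 \<le> \<alpha>" "0 < L" "L \<le> U"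
    and w: "w \<in> weights" and srt: "sorts (srt w) w"
  shows "result (oaa_rounding srt \<epsilon> \<alpha> (L, U) w) \<in> grid \<epsilon> \<alpha> (L, U)"
    and "runtime (oaa_rounding srt \<epsilon> \<alpha> (L, U) w) \<le> 21 * CARD('d) ^ 2"
    and "\<And>y y'. (\<And>i. y $ i \<in> {0} \<union> {L..U}) \<Longrightarrow> (\<And>i. y' $ i \<in> {0} \<union> {L..U}) \<Longrightarrow>
      result (oaa_rounding srt \<epsilon> \<alpha> (L, U) w) \<bullet> y \<le> \<alpha> * (result (oaa_rounding srt \<epsilon> \<alpha> (L, U) w) \<bullet> y') \<Longrightarrow>
      w \<bullet> y \<le> (1 + \<epsilon>) * \<alpha> * (w \<bullet> y')"
proof -
  let ?e = "eps' \<epsilon>" and ?c = "ratio_c \<epsilon> \<alpha> (L, U)"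
  note e = eps'_properties[OF \<epsilon>] and c = ratio_c_properties[OF \<epsilon> \<alpha>]
  obtain w' bool t' where br: "boundary_rounding srt ?c w = ((w', bool), t')"
    by (metis prod.exhaust)
  define \<delta> where "\<delta> = (if bool then ?e else \<epsilon>)"
  have round: "oaa_rounding srt \<epsilon> \<alpha> (L, U) w = (result (grid_rounding \<delta> w'), t' + 6 * CARD('d))"
    by (simp add: oaa_rounding_def br \<delta>_def grid_rounding_def)
  have \<beta>: "1 \<le> (1 + ?e) * \<alpha>" using e \<alpha> mult_mono[of 1 "1 + ?e" 1 \<alpha>] by simp
  note br_props = boundary_rounding_properties[where srt = srt, OF w srt c(1,4) eq_refl[OF c(2)] \<alpha>(2,3) \<beta> e(1,2) br]
  show "result (oaa_rounding srt \<epsilon> \<alpha> (L, U) w) \<in> grid \<epsilon> \<alpha> (L, U)"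
    unfolding round using grid_rounding_in_grid[OF \<epsilon> \<alpha> br_props(1,2), of \<delta>] by (simp add: \<delta>_def)
  show "runtime (oaa_rounding srt \<epsilon> \<alpha> (L, U) w) \<le> 21 * CARD('d) ^ 2"
    unfolding round snd_conv
    using le_square[of "CARD('d)"] br_props(5) unfolding power2_eq_square by linarith
  fix y y' :: "real ^ 'd"
  assume y: "\<And>i. y $ i \<in> {0} \<union> {L..U}" "\<And>i. y' $ i \<in> {0} \<union> {L..U}"
    and le: "result (oaa_rounding srt \<epsilon> \<alpha> (L, U) w) \<bullet> y \<le> \<alpha> * (result (oaa_rounding srt \<epsilon> \<alpha> (L, U) w) \<bullet> y')"
  have "0 \<le> y $ i" "0 \<le> y' $ i" for i using y[of i] \<alpha> by auto
  then have y0: "0 \<le> y" "0 \<le> y'" by (auto simp: less_eq_vec_def)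
  have "0 < w' $ i" for i
    using weight_lb_bounds(1)[OF c(1,4), of "CARD('d)"] br_props(2)[of i] by linarith
  moreover have "0 < \<delta>" using \<epsilon> e by (simp add: \<delta>_def)
  ultimately have w'_le: "w' \<bullet> y \<le> (1 + \<delta>) * \<alpha> * (w' \<bullet> y')"
    using le \<alpha> y0 unfolding round by (intro grid_rounding_approximates) auto
  show "w \<bullet> y \<le> (1 + \<epsilon>) * \<alpha> * (w \<bullet> y')"
  proof (cases bool)
    case True
    then have "w \<bullet> y \<le> (1 + ?e) * ((1 + ?e) * \<alpha>) * (w \<bullet> y')"
      using w'_le by (intro br_props(4) y) (simp add: \<delta>_def)
    then show ?thesis unfolding e(3)[symmetric] by (simp add: power2_eq_square mult.assoc)
  next
    case False
    then show ?thesis using w'_le br_props(3) by (simp add: \<delta>_def)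
  qed
qed

text \<open>In either sense the approximation is one inequality, with the roles of the solutions swapped.\<close>

lemma approximation_for_transfer:
  assumes app: "approximation_for s X f \<alpha> u x" and pos: "0 < \<alpha>" "0 < \<gamma>"
    and transfer: "\<And>x x'. x \<in> X \<Longrightarrow> x' \<in> X \<Longrightarrow> u \<bullet> f x \<le> \<alpha> * (u \<bullet> f x') \<Longrightarrow> w \<bullet> f x \<le> \<gamma> * (w \<bullet> f x')"
  shows "approximation_for s X f \<gamma> w x"
proof (cases s)
  case Minimize
  then show ?thesis using app transfer[of x] by (auto simp: approximation_for_def)
next
  case Maximize
  then show ?thesis
    using app transfer[of _ x] pos by (auto simp: approximation_for_def field_simps)
qed

lemma oaa_body_eq:
  "oaa_body s f b \<alpha> alg ext \<epsilon> srt sel st =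
     (let (w'', t) = oaa_rounding srt \<epsilon> \<alpha> b (fst (sel st)) in
      if w'' \<in> Rset st then st\<lparr>Mset := Mset st - {sel st}, clock := clock st + 4 + t\<rparr>
      else (let S = insert (result (alg w'')) (Sols st) in
        \<lparr>Sols = S, Rset = insert w'' (Rset st), Mset = result (extreme_points s f ext S),
         clock = clock st + 4 + t + runtime (alg w'') + 2 + runtime (extreme_points s f ext S)\<rparr>))"
  by (simp add: oaa_body_def oaa_rounding_def Let_def split: prod.splits)

section \<open>Cost of computing the extreme points\<close>

lemma polyhedron_polyhedron_of: "finite H \<Longrightarrow> polyhedron (polyhedron_of H)"
  unfolding polyhedron_of_def
  by (intro polyhedron_Inter) (auto simp: polyhedron_halfspace_le)

lemma card_D_halfspaces:
  fixes f :: "'x \<Rightarrow> real ^ 'd::finite"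
  assumes "finite S"
  shows "finite (D_halfspaces s f S)" "1 \<le> card (D_halfspaces s f S)"
    "card (D_halfspaces s f S) \<le> card S + CARD('d) + 2"
proof -
  define A where "A = (case s of
        Minimize \<Rightarrow> (\<lambda>x. ((- f x, 1 :: real), 0 :: real)) ` S
      | Maximize \<Rightarrow> (\<lambda>x. ((f x, - 1), 0)) ` S)"
  define B where "B = range (\<lambda>i :: 'd. ((- axis i 1 :: real ^ 'd, 0 :: real), 0 :: real))"
  define C where "C = {(((\<chi> i. 1) :: real ^ 'd, 0 :: real), 1 :: real), (((\<chi> i. - 1), 0), - 1)}"
  have D: "D_halfspaces s f S = A \<union> B \<union> C" by (simp add: D_halfspaces_def A_def B_def C_def)
  have "finite A" "card A \<le> card S"
    using assms by (cases s; simp add: A_def card_image_le)+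
  moreover have "finite B" "card B \<le> CARD('d)" by (simp_all add: B_def card_image_le)
  moreover have "finite C" "card C \<le> 2" by (simp_all add: C_def card_insert_if)
  ultimately show "finite (D_halfspaces s f S)" "card (D_halfspaces s f S) \<le> card S + CARD('d) + 2"
    unfolding D using card_Un_le[of "A \<union> B" C] card_Un_le[of A B] by auto
  moreover have "C \<noteq> {}" by (simp add: C_def)
  ultimately show "1 \<le> card (D_halfspaces s f S)" unfolding D by (simp add: Suc_le_eq card_gt_0_iff)
qed

text \<open>With at most \<open>N\<close> solutions, \<open>N \<ge> 1\<close>, there are at most
  \<open>N + d + 2 \<le> (d + 3) * N\<close> half-spaces. The first summand is the cost of writing
  them down; the square comes from estimating the logarithm in n log n by n.\<close>

definition extreme_points_bound :: "nat \<Rightarrow> real \<Rightarrow> nat \<Rightarrow> real" where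
  "extreme_points_bound d K N =
     real ((d + 3) * N) * (real d + 2) + \<bar>K\<bar> * (real ((d + 3) * N) ^ 2 + real ((d + 3) * N) ^ (d div 2))"

lemma extreme_points_properties:
  fixes f :: "'x \<Rightarrow> real ^ 'd::finite"
  assumes ext: "\<And>H. finite H \<Longrightarrow> aff_dim (polyhedron_of H) = int CARD('d) \<Longrightarrow>
        result (ext H) = {p. p extreme_point_of polyhedron_of H} \<and>
        card (result (ext H)) \<le> runtime (ext H) \<and>
        real (runtime (ext H)) \<le>
          K * (real (card H) * log 2 (real (card H)) + real (card H) ^ (CARD('d) div 2))"
    and S: "finite S" "S \<noteq> {}" "card S \<le> N"
  shows "result (extreme_points s f ext S) = {p. p extreme_point_of Dset s f S}"
    and "finite (result (extreme_points s f ext S))"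
    and "card (result (extreme_points s f ext S)) \<le> runtime (extreme_points s f ext S)"
    and "real (runtime (extreme_points s f ext S)) \<le> extreme_points_bound CARD('d) K N"
proof -
  let ?H = "D_halfspaces s f S" and ?d = "CARD('d)"
  define n where "n = card ?H"
  have H: "polyhedron_of ?H = Dset s f S" by (rule polyhedron_of_D_halfspaces) fact
  note fin = card_D_halfspaces[OF S(1), of s f]
  have ext_H: "result (ext ?H) = {p. p extreme_point_of Dset s f S}"
    "card (result (ext ?H)) \<le> runtime (ext ?H)"
    "real (runtime (ext ?H)) \<le> K * (real n * log 2 (real n) + real n ^ (?d div 2))"
    using ext[OF fin(1)] aff_dim_Dset[OF S(1,2), of s f] by (auto simp: H n_def)
  have eq: "result (extreme_points s f ext S) = result (ext ?H)"
    "runtime (extreme_points s f ext S) = n * (?d + 2) + runtime (ext ?H)"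
    by (simp_all add: extreme_points_def Let_def n_def split: prod.splits)
  show "result (extreme_points s f ext S) = {p. p extreme_point_of Dset s f S}"
    using eq ext_H by simp
  show "finite (result (extreme_points s f ext S))"
    using finite_polyhedron_extreme_points[OF polyhedron_polyhedron_of[OF fin(1)]]
    by (simp add: eq ext_H H)
  show "card (result (extreme_points s f ext S)) \<le> runtime (extreme_points s f ext S)"
    using eq ext_H by simp
  have n1: "1 \<le> n" using fin by (simp add: n_def)
  have "1 \<le> N" using S by (metis One_nat_def Suc_leI card_gt_0_iff order_less_le_trans)
  then have "?d + 2 \<le> (?d + 2) * N" using mult_le_mono2[of 1 N "?d + 2"] by (simp only: mult_1_right)
  moreover have "n \<le> N + (?d + 2)" using fin(3) S(3) by (simp add: n_def)
  ultimately have "n \<le> (?d + 3) * N" by (simp add: algebra_simps)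
  moreover define m where "m = (?d + 3) * N"
  ultimately have n: "n \<le> m" by simp
  have "log 2 (real n) \<le> real n"
    using n1 by (metis less_exp log2_of_power_le less_imp_le order.strict_trans2 zero_less_one)
  then have "real n * log 2 (real n) \<le> real n ^ 2"
    unfolding power2_eq_square by (intro mult_left_mono) auto
  also have "\<dots> \<le> real m ^ 2" using n by (intro power_mono) auto
  finally have "real n * log 2 (real n) + real n ^ (?d div 2)
      \<le> real m ^ 2 + real m ^ (?d div 2)"
    using n by (intro add_mono power_mono) auto
  moreover have "0 \<le> real n * log 2 (real n) + real n ^ (?d div 2)"
    using n1 by simp
  ultimately have "K * (real n * log 2 (real n) + real n ^ (?d div 2))
      \<le> \<bar>K\<bar> * (real m ^ 2 + real m ^ (?d div 2))"
    by (intro mult_mono) auto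
  moreover have "real n * (real ?d + 2) \<le> real m * (real ?d + 2)"
    using n by (intro mult_right_mono) auto
  ultimately show "real (runtime (extreme_points s f ext S)) \<le> extreme_points_bound ?d K N"
    using ext_H(3) unfolding eq extreme_points_bound_def m_def[symmetric] by (simp add: algebra_simps)
qed

text \<open>For \<open>d \<ge> 2\<close> the exponent \<open>d div 2 + 1\<close> is at least 2 and
  absorbs the square; for \<open>d = 1\<close> it is 1, and \<open>N = 1\<close> makes all powers
  equal.\<close>

lemma extreme_points_bound_le:
  assumes "1 \<le> N" "d = 1 \<Longrightarrow> N = 1" "1 \<le> d"
  shows "extreme_points_bound d K N
    \<le> (real ((d + 3) * (d + 2)) + \<bar>K\<bar> * (real (d + 3) ^ 2 + real (d + 3) ^ (d div 2))) * real N ^ (d div 2 + 1)"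
proof -
  let ?M = "real N ^ (d div 2 + 1)"
  have N: "real N ^ k \<le> ?M" if "k \<le> 2" "d \<noteq> 1 \<or> k \<le> 1" for k
  proof (cases "d = 1")
    case False
    then have "1 \<le> d div 2" using assms(3) by simp
    then show ?thesis using assms(1) that by (intro power_increasing) auto
  qed (use assms in simp)
  have "real N ^ 1 \<le> ?M" by (rule N) auto
  moreover have N2: "real N ^ 2 \<le> ?M" using N[of 2] assms by (cases "d = 1") auto
  moreover have "real N ^ (d div 2) \<le> ?M" using assms by (intro power_increasing) auto
  ultimately have "real ((d + 3) * (d + 2)) * real N \<le> real ((d + 3) * (d + 2)) * ?M"
    "real ((d + 3) * N) ^ 2 \<le> real (d + 3) ^ 2 * ?M"
    "real ((d + 3) * N) ^ (d div 2) \<le> real (d + 3) ^ (d div 2) * ?M"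
    unfolding of_nat_mult[of "d + 3" N] power_mult_distrib power_one_right
    by (intro mult_left_mono; simp)+
  moreover have "real ((d + 3) * N) * (real d + 2) = real ((d + 3) * (d + 2)) * real N"
    by (simp add: algebra_simps)
  ultimately have "real ((d + 3) * N) * (real d + 2) \<le> real ((d + 3) * (d + 2)) * ?M"
    "real ((d + 3) * N) ^ 2 \<le> real (d + 3) ^ 2 * ?M"
    "real ((d + 3) * N) ^ (d div 2) \<le> real (d + 3) ^ (d div 2) * ?M"
    by (simp_all only:)
  then have "extreme_points_bound d K N \<le> real ((d + 3) * (d + 2)) * ?M
      + \<bar>K\<bar> * (real (d + 3) ^ 2 * ?M + real (d + 3) ^ (d div 2) * ?M)"
    unfolding extreme_points_bound_def by (intro add_mono mult_left_mono) auto
  then show ?thesis by (simp add: algebra_simps)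
qed

section \<open>A run of the algorithm on a fixed instance: invariant and amortized cost\<close>

locale oaa_run =
  fixes s :: sense and X :: "'x set" and f :: "'x \<Rightarrow> real ^ 'd::finite" and L U \<alpha> \<epsilon> :: real
    and tb :: nat and alg :: "real ^ 'd \<Rightarrow> 'x timed"
    and ext :: "'d halfspace set \<Rightarrow> ((real ^ 'd) \<times> real) set timed" and K :: real
    and srt :: "real ^ 'd \<Rightarrow> nat \<Rightarrow> 'd" and sel :: "('x, 'd) oaa_state \<Rightarrow> (real ^ 'd) \<times> real"
  assumes \<epsilon>: "0 < \<epsilon>" "\<epsilon> < 1" and \<alpha>LU: "1 \<le> \<alpha>" "0 < L" "L \<le> U"
    and objective_values: "\<And>x j. x \<in> X \<Longrightarrow> f x $ j \<in> {0} \<union> {L..U}"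
    and alg: "\<And>w. 0 \<le> w \<Longrightarrow> w \<noteq> 0 \<Longrightarrow> approximation_for s X f \<alpha> w (result (alg w))"
    and ext: "\<And>H. finite H \<Longrightarrow> aff_dim (polyhedron_of H) = int CARD('d) \<Longrightarrow>
        result (ext H) = {p. p extreme_point_of polyhedron_of H} \<and>
        card (result (ext H)) \<le> runtime (ext H) \<and>
        real (runtime (ext H)) \<le>
          K * (real (card H) * log 2 (real (card H)) + real (card H) ^ (CARD('d) div 2))"
    and srt: "\<And>w. sorts (srt w) w"
    and sel: "\<And>st. Mset st \<noteq> {} \<Longrightarrow> sel st \<in> Mset st"
begin

definition G :: "(real ^ 'd) set" where "G = grid \<epsilon> \<alpha> (L, U)"
definition rounding :: "real ^ 'd \<Rightarrow> (real ^ 'd) timed" where "rounding = oaa_rounding srt \<epsilon> \<alpha> (L, U)"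
definition iter_cost :: nat where "iter_cost = 21 * CARD('d) ^ 2 + 4"
definition ext_cost :: real where "ext_cost = extreme_points_bound CARD('d) K (card G)"
definition T_alg :: nat where "T_alg = worst_runtime alg G"
text \<open>The charge for each element of \<open>R\<close>: one call of the weighted sum algorithm,
  the current iteration, two insertions, one computation of extreme points, and a prepayment of
  \<open>iter_cost\<close> for each of the at most \<open>ext_cost\<close> points it yields.\<close>

definition step_cost :: real where "step_cost = T_alg + iter_cost + 2 + (1 + iter_cost) * ext_cost"

definition init :: "('x, 'd) oaa_state" where
  "init = oaa_init s f ((L, U), tb) alg ext"
definition body :: "('x, 'd) oaa_state \<Rightarrow> ('x, 'd) oaa_state" where
  "body = oaa_body s f (L, U) \<alpha> alg ext \<epsilon> srt sel"

text \<open>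
  The last conjunct amortizes the clock: every element of \<open>Mset\<close> is prepaid with the cost of the
  iteration that removes it.
\<close>

definition invariant :: "('x, 'd) oaa_state \<Rightarrow> bool" where
  "invariant st \<longleftrightarrow> Rset st \<subseteq> G \<and> finite (Sols st) \<and> Sols st \<noteq> {} \<and> Sols st \<subseteq> X \<and>
     card (Sols st) \<le> card (Rset st) \<and>
     (\<forall>w\<in>Rset st. \<exists>x\<in>Sols st. approximation_for s X f \<alpha> w x) \<and>
     Mset st \<subseteq> {p. p extreme_point_of Dset s f (Sols st)} \<and>
     (\<forall>p. p extreme_point_of Dset s f (Sols st) \<longrightarrow> p \<in> Mset st \<or> result (rounding (fst p)) \<in> Rset st) \<and>
     finite (Mset st) \<and> real (card (Mset st)) \<le> ext_cost \<and>
     real (clock st) + iter_cost * card (Mset st) \<le> tb + 8 + CARD('d) + card (Rset st) * step_cost"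

lemma finite_G: "finite G"
  by (simp add: G_def finite_grid)

lemma grid_weight:
  assumes "w \<in> G"
  shows "w \<in> weights" "approximation_for s X f \<alpha> w (result (alg w))" "result (alg w) \<in> X"
    "runtime (alg w) \<le> T_alg"
proof -
  show w: "w \<in> weights" using grid_subset_weights[OF \<epsilon>(1)] assms by (auto simp: G_def)
  then have "w \<noteq> 0" by (auto simp: weights_iff)
  then show "approximation_for s X f \<alpha> w (result (alg w))"
    using w by (intro alg) (auto simp: weights_def)
  then show "result (alg w) \<in> X" by (simp add: approximation_for_def)
  show "runtime (alg w) \<le> T_alg"
    unfolding T_alg_def worst_runtime_def using assms finite_G by (intro Max_ge) auto
qed

lemma rounding_properties:
  assumes w: "w \<in> weights"
  shows "result (rounding w) \<in> G" "runtime (rounding w) + 4 \<le> iter_cost"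
    "approximation_for s X f \<alpha> (result (rounding w)) x \<Longrightarrow> approximation_for s X f ((1 + \<epsilon>) * \<alpha>) w x"
proof -
  note props = oaa_rounding_properties[where srt = srt, OF \<epsilon> \<alpha>LU w srt, folded rounding_def]
  show "result (rounding w) \<in> G" "runtime (rounding w) + 4 \<le> iter_cost"
    using props by (auto simp: G_def iter_cost_def)
  assume "approximation_for s X f \<alpha> (result (rounding w)) x"
  then show "approximation_for s X f ((1 + \<epsilon>) * \<alpha>) w x"
    by (rule approximation_for_transfer) (use \<epsilon> \<alpha>LU in \<open>auto intro!: props(3) dest: objective_values\<close>)
qed

lemma extreme_points_of_D:
  assumes "finite S" "S \<noteq> {}" "card S \<le> card G"
  shows "result (extreme_points s f ext S) = {p. p extreme_point_of Dset s f S}"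
    "finite (result (extreme_points s f ext S))"
    "card (result (extreme_points s f ext S)) \<le> ext_cost" "runtime (extreme_points s f ext S) \<le> ext_cost"
    "runtime (extreme_points s f ext S) + iter_cost * card (result (extreme_points s f ext S)) \<le> (1 + iter_cost) * ext_cost"
proof -
  note props = extreme_points_properties[where K = K and s = s and f = f, OF ext assms]
  show "result (extreme_points s f ext S) = {p. p extreme_point_of Dset s f S}"
    "finite (result (extreme_points s f ext S))"
    using props by blast+
  show ext_cost: "card (result (extreme_points s f ext S)) \<le> ext_cost" "runtime (extreme_points s f ext S) \<le> ext_cost"
    using props(3,4) by (auto simp: ext_cost_def)
  have "iter_cost * real (card (result (extreme_points s f ext S))) \<le> iter_cost * ext_cost"
    using ext_cost(1) by (rule mult_left_mono) simp
  then show "runtime (extreme_points s f ext S) + iter_cost * card (result (extreme_points s f ext S)) \<le> (1 + iter_cost) * ext_cost"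
    using ext_cost(2) by (simp add: algebra_simps)
qed

lemma invariant_init: "invariant init"
proof -
  let ?w = "(\<chi> i. 1 / real CARD('d)) :: real ^ 'd"
  let ?x = "result (alg ?w)"
  have w: "?w \<in> G" using uniform_in_grid[OF \<epsilon> \<alpha>LU] by (simp add: G_def)
  then have "card {?x} \<le> card G" using finite_G by (simp add: Suc_le_eq card_gt_0_iff) blast
  note props = extreme_points_of_D[OF _ _ this]
  have init: "init = \<lparr>Sols = {?x}, Rset = {?w}, Mset = result (extreme_points s f ext {?x}),
      clock = tb + 8 + CARD('d) + runtime (alg ?w) + 2 + runtime (extreme_points s f ext {?x})\<rparr>"
    by (simp add: init_def oaa_init_def Let_def split: prod.splits)
  show ?thesis
    using w props grid_weight[OF w]
    by (simp add: init invariant_def step_cost_def)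
qed

lemma body_step:
  assumes invariant: "invariant st" and M: "Mset st \<noteq> {}"
  shows "invariant (body st)" and
    "Rset (body st) = Rset st \<and> card (Mset (body st)) < card (Mset st) \<or>
     card (Rset (body st)) = card (Rset st) + 1"
proof -
  note st = invariant[unfolded invariant_def]
  define w where "w = fst (sel st)"
  have sel: "sel st \<in> Mset st" using M by (rule sel)
  then have "sel st \<in> Dset s f (Sols st)" using st by (auto simp: extreme_point_of_def)
  then have "w \<in> weights" using st by (auto simp: Dset_def Hset_def w_def)
  note rounding = rounding_properties[OF this]
  have body: "body st = (if result (rounding w) \<in> Rset st
      then st\<lparr>Mset := Mset st - {sel st}, clock := clock st + 4 + runtime (rounding w)\<rparr>
      else (let w'' = result (rounding w); S = insert (result (alg w'')) (Sols st) in
        \<lparr>Sols = S, Rset = insert w'' (Rset st), Mset = result (extreme_points s f ext S),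
         clock = clock st + 4 + runtime (rounding w) + runtime (alg w'') + 2 + runtime (extreme_points s f ext S)\<rparr>))"
    unfolding body_def oaa_body_eq rounding_def w_def by (simp add: Let_def split: prod.splits)
  have card_M: "card (Mset st) = Suc (card (Mset st - {sel st}))"
    using st sel by (metis card_Suc_Diff1)
  have "invariant (body st) \<and> (Rset (body st) = Rset st \<and> card (Mset (body st)) < card (Mset st) \<or>
     card (Rset (body st)) = card (Rset st) + 1)"
  proof (cases "result (rounding w) \<in> Rset st")
    case True
    have "p \<in> Mset st - {sel st} \<or> result (rounding (fst p)) \<in> Rset st"
      if "p extreme_point_of Dset s f (Sols st)" for p
    proof -
      have "p \<in> Mset st \<or> result (rounding (fst p)) \<in> Rset st" using that st by blast
      then show ?thesis using True by (auto simp: w_def)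
    qed
    \<comment> \<open>The removed element releases its prepaid \<open>iter_cost\<close>, which
      covers this iteration.\<close>
    moreover have "real (clock st + 4 + runtime (rounding w)) + iter_cost * card (Mset st - {sel st})
        \<le> tb + 8 + CARD('d) + card (Rset st) * step_cost"
      using st rounding(2) unfolding card_M by (simp add: algebra_simps)
    ultimately show ?thesis
      using True st card_M by (auto simp: body invariant_def)
  next
    case False
    define w'' where "w'' = result (rounding w)"
    define S where "S = insert (result (alg w'')) (Sols st)"
    have w'': "w'' \<in> G" using rounding(1) by (simp add: w''_def)
    have R: "finite (Rset st)" using st finite_G finite_subset by blast
    then have card_R: "card (insert w'' (Rset st)) = card (Rset st) + 1"
      using False by (simp add: w''_def)
    have "card S \<le> card (Sols st) + 1" using st by (simp add: S_def card_insert_if)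
    also have "\<dots> \<le> card (insert w'' (Rset st))" using st card_R by simp
    finally have S: "card S \<le> card (insert w'' (Rset st))" .
    also have "\<dots> \<le> card G" using st w'' finite_G by (intro card_mono) auto
    finally have S_G: "card S \<le> card G" .
    have "finite S" "S \<noteq> {}" using st by (auto simp: S_def)
    note props = extreme_points_of_D[OF this S_G]
    have body: "body st = \<lparr>Sols = S, Rset = insert w'' (Rset st), Mset = result (extreme_points s f ext S),
         clock = clock st + 4 + runtime (rounding w) + runtime (alg w'') + 2 + runtime (extreme_points s f ext S)\<rparr>"
      using False by (simp add: body Let_def S_def w''_def)
    \<comment> \<open>The credit of the discarded elements of \<open>Mset\<close> is given up; the
      additional \<open>step_cost\<close> pays for this iteration and for the new set.\<close>
    have "real (clock st) \<le> tb + 8 + CARD('d) + card (Rset st) * step_cost"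
      using st by (smt (verit) mult_nonneg_nonneg of_nat_0_le_iff)
    moreover have "real (runtime (rounding w) + 4 + runtime (alg w'')) \<le> real (iter_cost + T_alg)"
      unfolding of_nat_le_iff using rounding(2) grid_weight(4)[OF w''] by linarith
    ultimately have "real (clock (body st)) + iter_cost * card (Mset (body st))
        \<le> tb + 8 + CARD('d) + card (Rset (body st)) * step_cost"
      using props(5) by (simp add: body card_R step_cost_def algebra_simps)
    moreover have "\<exists>x\<in>S. approximation_for s X f \<alpha> v x" if "v \<in> insert w'' (Rset st)" for v
      using that st grid_weight(2)[OF w''] by (auto simp: S_def)
    moreover have "S \<subseteq> X" using st grid_weight(3)[OF w''] by (auto simp: S_def)
    ultimately show ?thesis
      using st S w'' props card_R \<open>finite S\<close> \<open>S \<noteq> {}\<close> by (simp add: body invariant_def)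
  qed
  then show "invariant (body st)" and
    "Rset (body st) = Rset st \<and> card (Mset (body st)) < card (Mset st) \<or>
     card (Rset (body st)) = card (Rset st) + 1"
    by blast+
qed

section \<open>Termination and correctness\<close>

definition potential :: "('x, 'd) oaa_state \<Rightarrow> nat" where
  "potential st = (card G - card (Rset st)) * (nat \<lfloor>ext_cost\<rfloor> + 1) + card (Mset st)"

lemma potential_decreases:
  assumes invariant: "invariant st" and M: "Mset st \<noteq> {}"
  shows "potential (body st) < potential st"
proof -
  note body = body_step[OF assms]
  have "card (Mset (body st)) \<le> nat \<lfloor>ext_cost\<rfloor>"
    using body(1) unfolding invariant_def by linarith
  moreover have "card (Rset (body st)) \<le> card G"
    using body(1) finite_G by (auto simp: invariant_def intro: card_mono)
  ultimately show ?thesis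
  proof (cases "Rset (body st) = Rset st")
    case False
    then have R: "card (Rset (body st)) = card (Rset st) + 1" using body(2) by blast
    then have "card G - card (Rset st) = Suc (card G - card (Rset (body st)))"
      using \<open>card (Rset (body st)) \<le> card G\<close> by linarith
    then show ?thesis using \<open>card (Mset (body st)) \<le> nat \<lfloor>ext_cost\<rfloor>\<close> by (simp add: potential_def)
  qed (use body(2) in \<open>auto simp: potential_def\<close>)
qed

lemma oaa_terminates:
  obtains st where "oaa s f ((L, U), tb) \<alpha> alg ext \<epsilon> srt sel = Some (Sols st, clock st + 1)"
    "invariant st" "Mset st = {}"
proof -
  have "\<exists>st. while_option (\<lambda>st. Mset st \<noteq> {}) body init = Some st"
    using body_step(1) potential_decreases invariant_init
    by (intro measure_while_option_Some[where P = invariant and f = potential]) auto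
  then obtain st where st: "while_option (\<lambda>st. Mset st \<noteq> {}) body init = Some st" ..
  have "invariant st"
    by (rule while_option_rule[where P = invariant, OF _ st invariant_init]) (rule body_step(1))
  moreover have "Mset st = {}" using while_option_stop[OF st] by simp
  moreover have "oaa s f ((L, U), tb) \<alpha> alg ext \<epsilon> srt sel = Some (Sols st, clock st + 1)"
    using st by (simp add: oaa_def body_def init_def)
  ultimately show thesis using that by blast
qed

text \<open>With \<open>Mset\<close> empty, the invariant says that the rounded weight of every
  extreme point is in \<open>Rset\<close>, so \<open>Sols\<close> contains an \<alpha>-approximation
  for it, which transfers back to the extreme point itself.\<close>

lemma convex_approximation:
  assumes invariant: "invariant st" and M: "Mset st = {}"
  shows "convex_approximation_set s X f ((1 + \<epsilon>) * \<alpha>) (Sols st)"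
proof (rule convex_approximation_setI)
  note st = invariant[unfolded invariant_def]
  show "finite (Sols st)" "Sols st \<noteq> {}" "Sols st \<subseteq> X" using st by auto
  show "0 < (1 + \<epsilon>) * \<alpha>" using \<epsilon> \<alpha>LU by simp
  fix w z assume e: "(w, z) extreme_point_of Dset s f (Sols st)"
  then have "w \<in> weights" using st by (auto simp: extreme_point_of_def Dset_def Hset_def)
  moreover have "result (rounding w) \<in> Rset st" using e st M by fastforce
  then obtain x where "x \<in> Sols st" "approximation_for s X f \<alpha> (result (rounding w)) x" using st by blast
  ultimately show "\<exists>x\<in>Sols st. approximation_for s X f ((1 + \<epsilon>) * \<alpha>) w x"
    using rounding_properties(3) by blast
qed

section \<open>The total running time\<close>

definition ext_factor :: real where
  "ext_factor = real ((CARD('d) + 3) * (CARD('d) + 2)) +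
     \<bar>K\<bar> * (real (CARD('d) + 3) ^ 2 + real (CARD('d) + 3) ^ (CARD('d) div 2))"

text \<open>At most \<open>card G\<close> charges of \<open>step_cost\<close> occur. Each contains a
  multiple of \<open>ext_cost\<close>, of order \<open>card G ^ (d div 2 + 1)\<close>, which
  accounts for the exponent \<open>d div 2 + 2\<close>; the other terms, except for the calls of
  \<open>alg\<close>, are absorbed because the grid is nonempty.\<close>

lemma clock_bound:
  assumes invariant: "invariant st"
  shows "real (clock st + 1) \<le> tb + card G * T_alg
    + (9 + CARD('d) + iter_cost + 2 + (1 + iter_cost) * ext_factor) * real (card G) ^ (CARD('d) div 2 + 2)"
proof -
  let ?p = "CARD('d) div 2 + 2"
  define N where "N = card G"
  have R: "card (Rset st) \<le> N"
    using invariant finite_G by (auto simp: invariant_def N_def intro: card_mono)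
  have N1: "1 \<le> N"
    using uniform_in_grid[OF \<epsilon> \<alpha>LU] finite_G by (auto simp: N_def G_def Suc_le_eq card_gt_0_iff)
  have "N = 1" if "CARD('d) = 1"
    using card_grid_le_1[OF \<epsilon>(1) that, of \<alpha> "(L, U)"] N1 by (simp add: N_def G_def)
  then have "ext_cost \<le> ext_factor * real N ^ (CARD('d) div 2 + 1)"
    using N1 unfolding ext_cost_def ext_factor_def N_def[symmetric]
    by (intro extreme_points_bound_le) (auto simp: Suc_le_eq)
  then have "real N * ext_cost \<le> real N * (ext_factor * real N ^ (CARD('d) div 2 + 1))"
    by (rule mult_left_mono) simp
  then have NE: "real N * ext_cost \<le> ext_factor * real N ^ ?p" by (simp add: algebra_simps)
  have "0 \<le> ext_cost" using invariant by (auto simp: invariant_def intro: order.trans[OF of_nat_0_le_iff])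
  then have "0 \<le> step_cost" by (simp add: step_cost_def)
  then have "card (Rset st) * step_cost \<le> N * step_cost"
    using R by (intro mult_right_mono) auto
  moreover have "real (clock st) \<le> tb + 8 + CARD('d) + card (Rset st) * step_cost"
    using invariant unfolding invariant_def by (smt (verit) mult_nonneg_nonneg of_nat_0_le_iff)
  ultimately have "real (clock st + 1) \<le> tb + (9 + CARD('d)) + N * step_cost" by simp
  also have "N * step_cost = N * T_alg + (iter_cost + 2) * N + (1 + iter_cost) * (N * ext_cost)"
    by (simp add: step_cost_def algebra_simps)
  finally have "real (clock st + 1) \<le> tb + (9 + CARD('d)) + (N * T_alg + (iter_cost + 2) * N + (1 + iter_cost) * (N * ext_cost))" .
  moreover have "(1 + iter_cost) * (N * ext_cost) \<le> (1 + iter_cost) * (ext_factor * real N ^ ?p)"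
    using NE by (intro mult_left_mono) auto
  moreover have "(iter_cost + 2) * real N \<le> (iter_cost + 2) * real N ^ ?p"
    using N1 self_le_power[of "real N" ?p] by (intro mult_left_mono) auto
  moreover have "real (9 + CARD('d)) * 1 \<le> real (9 + CARD('d)) * real N ^ ?p"
    using N1 by (intro mult_left_mono one_le_power) auto
  ultimately show ?thesis unfolding N_def[symmetric] by (simp add: algebra_simps)
qed

end

theorem theorem4p6:
  fixes ext :: "'d::finite halfspace set \<Rightarrow> ((real ^ 'd) \<times> real) set timed"
  assumes "extreme_point_algorithm ext"
  shows "\<exists>C::real.
    \<forall>(P :: ('i, 'x, 'd) problem) m eval bnd wenc \<alpha> alg \<epsilon> srt sel i.
      standing_assumptions P m eval bnd \<and>
      1 \<le> \<alpha> \<and> weighted_sum_algorithm P wenc \<alpha> alg \<and>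
      0 < \<epsilon> \<and> \<epsilon> < 1 \<and>
      (\<forall>w. sorts (srt w) w) \<and>
      (\<forall>st. Mset st \<noteq> {} \<longrightarrow> sel st \<in> Mset st) \<longrightarrow>
      (let G = grid \<epsilon> \<alpha> (result (bnd i)) :: (real ^ 'd) set;
           T_bounds = runtime (bnd i);
           T_alg = worst_runtime (alg i) G
       in \<exists>S t.
            oaa (sense P) (objective P i) (bnd i) \<alpha> (alg i) ext \<epsilon> srt sel = Some (S, t) \<and>
            convex_approximation_set (sense P) (feasible P i) (objective P i) ((1 + \<epsilon>) * \<alpha>) S \<and>
            real t \<le> C * (real T_bounds + real (card G) ^ (CARD('d) div 2 + 2)
                           + real (card G) * real T_alg))"
proof -
  obtain K where ext: "\<And>H. finite H \<Longrightarrow> aff_dim (polyhedron_of H) = int CARD('d) \<Longrightarrow>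
        result (ext H) = {p. p extreme_point_of polyhedron_of H} \<and>
        card (result (ext H)) \<le> runtime (ext H) \<and>
        real (runtime (ext H)) \<le>
          K * (real (card H) * log 2 (real (card H)) + real (card H) ^ (CARD('d) div 2))"
    using assms unfolding extreme_point_algorithm_def by blast
  let ?d = "CARD('d)"
  define k where "k = real ((?d + 3) * (?d + 2)) + \<bar>K\<bar> * (real (?d + 3) ^ 2 + real (?d + 3) ^ (?d div 2))"
  \<comment> \<open>The coefficient from \<open>clock_bound\<close> with its abbreviations expanded.
    It depends only on d and \<open>K\<close>, so it can be chosen before the instance, \<alpha>,
    \<epsilon> and the selection rule.\<close>
  define C where "C = 9 + ?d + (21 * ?d ^ 2 + 4) + 2 + (1 + (21 * ?d ^ 2 + 4)) * k"
  have "0 \<le> k" by (simp add: k_def)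
  then have C: "1 \<le> C" by (simp add: C_def)
  show ?thesis
  proof (intro exI[of _ C] allI impI, elim conjE, unfold Let_def)
    fix P :: "('i, 'x, 'd) problem" and m and eval :: "'i \<Rightarrow> 'x \<Rightarrow> (real ^ 'd) timed"
      and bnd :: "'i \<Rightarrow> (real \<times> real) timed" and wenc :: "real ^ 'd \<Rightarrow> nat" and \<alpha> :: real
      and alg :: "'i \<Rightarrow> real ^ 'd \<Rightarrow> 'x timed" and \<epsilon> :: real and srt :: "real ^ 'd \<Rightarrow> nat \<Rightarrow> 'd"
      and sel :: "('x, 'd) oaa_state \<Rightarrow> (real ^ 'd) \<times> real" and i :: 'i
    assume sa: "standing_assumptions P m eval bnd" and \<alpha>: "1 \<le> \<alpha>"
      and alg: "weighted_sum_algorithm P wenc \<alpha> alg" and \<epsilon>: "0 < \<epsilon>" "\<epsilon> < 1"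
      and srt: "\<forall>w. sorts (srt w) w" and sel: "\<forall>st. Mset st \<noteq> {} \<longrightarrow> sel st \<in> Mset st"
    obtain L U tb where bnd: "bnd i = ((L, U), tb)" by (metis prod.exhaust)
    note bounds = sa[unfolded standing_assumptions_def, THEN conjunct2, THEN conjunct2,
        THEN conjunct2, THEN conjunct2, THEN conjunct2, THEN conjunct1, THEN spec, of i]
    have LU: "0 < L" "L \<le> U" "\<And>x j. x \<in> feasible P i \<Longrightarrow> objective P i x $ j \<in> {0} \<union> {L..U}"
      using bounds unfolding bnd fst_conv split_conv by blast+
    interpret oaa_run "sense P" "feasible P i" "objective P i" L U \<alpha> \<epsilon> tb "alg i" ext K srt sel
    proof
      show "approximation_for (sense P) (feasible P i) (objective P i) \<alpha> w (result (alg i w))"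
        if "0 \<le> w" "w \<noteq> 0" for w
        using alg that unfolding weighted_sum_algorithm_def by blast
    qed (use \<epsilon> \<alpha> LU ext srt sel in blast)+
    obtain st where st: "oaa (sense P) (objective P i) (bnd i) \<alpha> (alg i) ext \<epsilon> srt sel
        = Some (Sols st, clock st + 1)" "invariant st" "Mset st = {}"
      using oaa_terminates unfolding bnd by blast
    have "real (clock st + 1) \<le> tb + card G * T_alg + C * real (card G) ^ (?d div 2 + 2)"
      using clock_bound[OF st(2)] by (simp add: C_def k_def iter_cost_def ext_factor_def)
    also have "\<dots> \<le> C * tb + C * (card G * T_alg) + C * real (card G) ^ (?d div 2 + 2)"
      using C mult_right_mono[of 1 C "real tb"] mult_right_mono[of 1 C "real (card G * T_alg)"] by simp
    also have "\<dots> = C * (tb + real (card G) ^ (?d div 2 + 2) + card G * T_alg)"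
      by (simp add: algebra_simps)
    finally show "\<exists>S t. oaa (sense P) (objective P i) (bnd i) \<alpha> (alg i) ext \<epsilon> srt sel = Some (S, t) \<and>
        convex_approximation_set (sense P) (feasible P i) (objective P i) ((1 + \<epsilon>) * \<alpha>) S \<and>
        real t \<le> C * (real (runtime (bnd i)) + real (card (grid \<epsilon> \<alpha> (result (bnd i)) :: (real ^ 'd) set)) ^ (?d div 2 + 2)
          + real (card (grid \<epsilon> \<alpha> (result (bnd i)) :: (real ^ 'd) set))
              * real (worst_runtime (alg i) (grid \<epsilon> \<alpha> (result (bnd i)))))"
      using st(1) convex_approximation[OF st(2,3)] by (auto simp: bnd G_def T_alg_def)
  qed
qed

end
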